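(* Let $p$ be a prime. There exists $\gamma>0$ such that for all $\alpha>0$ there exists $c$ for which the following holds. Let $X$ and $Y$ be subsets of two intervals $I$ and $J$ of $\mathbb{Z}_p$ respectively (so $X\subset I$, $Y\subset J$), and let $1 \leq c_1 \leq |X|$ and $1 \leq c_2 \leq |Y|$ be integers such that $c_1c_2 \geq c\max(|X|,|Y|)$. Suppose that $\alpha |J| \leq |I| \leq \alpha^{-1}|J|$, $|I| +|J| \leq p$ and $\max(|I\setminus X|, |J \setminus Y| ) \leq \gamma \min(|I|, |J|)$. Then there exist $X' \in X^{(c_1)}$ and $Y' \in Y^{(c_2)}$ such that $|X'+Y'| \geq |X|+|Y|-1$.
   Context: An interval in $\mathbb{Z}_p$ is a set of consecutive residues $\{a, a+1, \dots, a+m-1\}$. For a finite set $S$ and integer $m$, $S^{(m)}$ denotes the family of all $m$-element subsets of $S$. $X'+Y'$ denotes the sumset. *)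

theory Defs
  imports "HOL-Number_Theory.Number_Theory" "HOL-Algebra.AbelCoset" "HOL-Library.Ramsey"
begin

(* The residues mod p are the carrier {0..p-1} of residue_ring p; an interval may wrap around. *)
definition residue_interval :: "nat \<Rightarrow> int set \<Rightarrow> bool" where
  "residue_interval p I \<longleftrightarrow>
     (\<exists>(a::int) (m::nat). I = (\<lambda>i. (a + int i) mod int p) ` {..<m})"

end

theory Submission
  imports Defs "HOL-Library.Set_Algebras"
begin

text \<open>
  Since the two intervals have total length at most \<open>p\<close>, there is no wrap-around and one may work with
  \<open>X \<subseteq> [0, m)\<close> and \<open>Y \<subseteq> [0, n)\<close> in the integers, where the number of sums that are missed must not
  exceed the total number of holes of \<open>X\<close> and \<open>Y\<close>. Fix \<open>L = R 4\<^sup>J\<close> of order \<open>min(m, n)\<close> such that \<open>2\<^sup>J\<close> and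
  \<open>R 2\<^sup>J\<close> are of order \<open>c\<^sub>1\<close> and \<open>c\<^sub>2\<close>.

  A sum \<open>s\<close> in the middle has about \<open>L\<close> representations, few of which are spoilt by holes. Adding a random
  block of \<open>X\<close> of length \<open>2\<^sup>J\<close> to a random residue class of \<open>Y\<close> modulo \<open>2\<^sup>J\<close>, and repeating this a
  bounded number of times, loses only a small multiple of the number of holes.

  At the left end (the right one is its mirror image) call \<open>(a, b)\<close> nice if the holes of \<open>X\<close> after \<open>a\<close> and of
  \<open>Y\<close> after \<open>b\<close> have small density at every scale. From a nice pair the random construction applied at
  geometrically growing scales covers \<open>a + b + [0, 4L)\<close> at a small cost, so what remains is to make up
  for the \<open>T = |X \<inter> [0, a)| + |Y \<inter> [0, b)|\<close> elements in front of it. Greedily chosen sums collect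
  them, together with a surplus, at some \<open>r \<ge> 8 T\<close>; if this fails for all \<open>r\<close>, then \<open>X\<close> and \<open>Y\<close> are so full near
  \<open>a\<close> and \<open>b\<close> that there is a nice pair with smaller \<open>T\<close>.
\<close>

section \<open>Holes and sumsets of integers\<close>

text \<open>Real-valued, because losses are charged to holes with fractional weights.\<close>

definition holes :: "int set \<Rightarrow> int \<Rightarrow> int \<Rightarrow> real" where
  "holes A u v = real (card ({u..<v} - A))"

lemma holes_nonneg [simp]: "0 \<le> holes A u v"
  by (simp add: holes_def)

lemma holes_empty [simp]: "v \<le> u \<Longrightarrow> holes A u v = 0"
  by (simp add: holes_def)

lemma holes_split:
  assumes "u \<le> v" "v \<le> w"
  shows "holes A u w = holes A u v + holes A v w"
proof -
  have "{u..<w} - A = ({u..<v} - A) \<union> ({v..<w} - A)"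
    using assms by auto
  moreover have "({u..<v} - A) \<inter> ({v..<w} - A) = {}" by auto
  ultimately show ?thesis
    by (simp add: holes_def card_Un_disjoint)
qed

lemma holes_mono:
  assumes "u' \<le> u" "v \<le> v'"
  shows "holes A u v \<le> holes A u' v'"
proof -
  have "{u..<v} - A \<subseteq> {u'..<v'} - A" using assms by auto
  then show ?thesis by (simp add: holes_def card_mono)
qed

lemma holes_plus_card:
  assumes "u \<le> v"
  shows "real (card (A \<inter> {u..<v})) + holes A u v = of_int (v - u)"
proof -
  have "{u..<v} = (A \<inter> {u..<v}) \<union> ({u..<v} - A)" by auto
  then have "card {u..<v} = card (A \<inter> {u..<v}) + card ({u..<v} - A)"
    by (metis Diff_disjoint Int_Diff Int_commute card_Un_disjoint finite_Diff finite_Int finite_atLeastLessThan_int inf_bot_right)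
  then show ?thesis using assms by (simp add: holes_def)
qed

lemma holes_reflect: "holes ((\<lambda>x. c - x) ` A) u v = holes A (c - v + 1) (c - u + 1)"
proof -
  have "{c - v + 1..<c - u + 1} - A = (\<lambda>x. c - x) ` ({u..<v} - (\<lambda>x. c - x) ` A)"
  proof (intro Set.set_eqI iffI)
    fix y assume y: "y \<in> {c - v + 1..<c - u + 1} - A"
    then have "c - y \<in> {u..<v} - (\<lambda>x. c - x) ` A" by (auto simp: image_iff)
    then show "y \<in> (\<lambda>x. c - x) ` ({u..<v} - (\<lambda>x. c - x) ` A)"
      by (intro image_eqI[of _ _ "c - y"]) auto
  next
    fix y assume "y \<in> (\<lambda>x. c - x) ` ({u..<v} - (\<lambda>x. c - x) ` A)"
    then obtain x where x: "y = c - x" "x \<in> {u..<v}" "x \<notin> (\<lambda>x. c - x) ` A" by auto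
    then have "c - x \<notin> A" using image_eqI[of x "\<lambda>x. c - x" "c - x" A] by auto
    then show "y \<in> {c - v + 1..<c - u + 1} - A" using x by auto
  qed
  moreover have "inj_on (\<lambda>x. c - x) ({u..<v} - (\<lambda>x. c - x) ` A)"
    by (auto simp: inj_on_def)
  ultimately show ?thesis by (simp add: holes_def card_image)
qed

lemma card_Int_split:
  fixes A :: "int set"
  assumes "u \<le> v" "v \<le> w"
  shows "card (A \<inter> {u..<w}) = card (A \<inter> {u..<v}) + card (A \<inter> {v..<w})"
proof -
  have "A \<inter> {u..<w} = (A \<inter> {u..<v}) \<union> (A \<inter> {v..<w})"
    using assms by auto
  moreover have "(A \<inter> {u..<v}) \<inter> (A \<inter> {v..<w}) = {}" by auto
  ultimately show ?thesis by (simp add: card_Un_disjoint)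
qed

section \<open>A one-sided maximal inequality and greedy growth of sumsets\<close>

text \<open>Scan from the left. A point that is bad through \<open>s\<close> allows a jump by
  \<open>s\<close>, and the at most \<open>s\<close> bad points skipped are paid for by
  \<open>k\<close> times the increment of \<open>F\<close> over the jump. The jumps are disjoint, so
  the payments telescope.\<close>

lemma rising_sun:
  fixes F :: "int \<Rightarrow> real" and k :: real
  assumes mono: "\<And>x y. i0 \<le> x \<Longrightarrow> x \<le> y \<Longrightarrow> F x \<le> F y" and k: "0 \<le> k" and M: "0 \<le> M"
    and "i0 \<le> n"
  shows "real (card {i \<in> {i0..<n}. \<exists>s\<in>{1..M}. k * (F (i + s) - F i) > of_int s})
           \<le> k * (F (n + M) - F i0)"
  using assms(4) mono
proof (induction "nat (n - i0)" arbitrary: i0 rule: less_induct)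
  case less
  define Bad where "Bad = (\<lambda>j. {i \<in> {j..<n}. \<exists>s\<in>{1..M}. k * (F (i + s) - F i) > of_int s})"
  have fin: "finite (Bad j)" for j
    by (rule finite_subset[of _ "{j..<n}"]) (auto simp: Bad_def)
  have IH: "real (card (Bad j)) \<le> k * (F (n + M) - F j)" if "i0 < j" "j \<le> n" for j
    unfolding Bad_def by (rule less.hyps) (use that less.prems in auto)
  show ?case
  proof (cases "i0 = n")
    case True
    then have "{i \<in> {i0..<n}. \<exists>s\<in>{1..M}. k * (F (i + s) - F i) > of_int s} = {}" by auto
    moreover have "0 \<le> k * (F (n + M) - F i0)" using less.prems M True k by auto
    ultimately show ?thesis by (simp only: card.empty of_nat_0)
  next
    case False
    then have lt: "i0 < n" using less.prems by simp
    show ?thesis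
    proof (cases "i0 \<in> Bad i0")
      case False
      have "Bad i0 = Bad (i0 + 1)"
      proof -
        have "x \<in> Bad (i0 + 1)" if "x \<in> Bad i0" for x
        proof -
          have "x \<noteq> i0" using that False by auto
          with that show ?thesis by (auto simp: Bad_def)
        qed
        then show ?thesis by (auto simp: Bad_def)
      qed
      moreover have "F i0 \<le> F (i0 + 1)" using less.prems by auto
      ultimately have "real (card (Bad i0)) \<le> k * (F (n + M) - F i0)"
        using IH[of "i0 + 1"] lt k mult_left_mono[of "F i0" "F (i0+1)" k]
        by (simp add: right_diff_distrib)
      then show ?thesis by (simp add: Bad_def)
    next
      case True
      then obtain s where s: "1 \<le> s" "s \<le> M" "k * (F (i0 + s) - F i0) > of_int s"
        by (auto simp: Bad_def)
      have "real (card (Bad i0)) \<le> k * (F (n + M) - F i0)"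
      proof (cases "i0 + s \<ge> n")
        case True
        \<comment> \<open>The jump leaves the range: at most \<open>n - i0 \<le> s\<close> points
          remain, and its endpoint \<open>i0 + s\<close> may lie beyond \<open>n\<close>, but not
          beyond \<open>n + M\<close>.\<close>
        have "card (Bad i0) \<le> card {i0..<n}"
          by (rule card_mono) (auto simp: Bad_def)
        then have "real (card (Bad i0)) \<le> of_int s" using True lt by simp
        moreover have "k * F (i0 + s) \<le> k * F (n + M)"
          using less.prems lt s k by (intro mult_left_mono) auto
        ultimately show ?thesis using s by (simp add: right_diff_distrib)
      next
        case False
        have "Bad i0 \<subseteq> {i0..<i0+s} \<union> Bad (i0 + s)" by (auto simp: Bad_def)
        then have "card (Bad i0) \<le> card ({i0..<i0+s} \<union> Bad (i0 + s))"
          using fin by (intro card_mono) auto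
        also have "\<dots> \<le> card {i0..<i0+s} + card (Bad (i0 + s))"
          by (rule card_Un_le)
        finally have "real (card (Bad i0)) \<le> of_int s + real (card (Bad (i0 + s)))"
          using s by simp
        also have "real (card (Bad (i0 + s))) \<le> k * (F (n + M) - F (i0 + s))"
          using False s by (intro IH) auto
        finally show ?thesis using s by (simp add: right_diff_distrib)
      qed
      then show ?thesis by (simp add: Bad_def)
    qed
  qed
qed

text \<open>As long as \<open>W = U + V'\<close> has fewer than \<open>(1 - e) |V|\<close> elements,
  averaging over \<open>v\<close> in \<open>V\<close> yields a translate of \<open>U\<close> with at
  least \<open>e |U|\<close> elements outside \<open>W\<close>: each \<open>u\<close> satisfies
  \<open>u + v \<in> W\<close> for at most \<open>|W|\<close> values of \<open>v\<close>.\<close>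

lemma greedy_sumset:
  fixes U V :: "int set" and e :: real
  assumes U: "finite U" and V: "finite V" and e: "0 \<le> e" "e \<le> 1"
  shows "\<exists>V'\<subseteq>V. card V' \<le> M \<and>
           min ((1 - e) * real (card V)) (real M * e * real (card U)) \<le> real (card (U + V'))"
proof (induction M)
  case 0
  show ?case using e by (intro exI[of _ "{}"]) auto
next
  case (Suc M)
  then obtain V' where V': "V' \<subseteq> V" "card V' \<le> M"
    "min ((1 - e) * real (card V)) (real M * e * real (card U)) \<le> real (card (U + V'))" by blast
  define W where "W = U + V'"
  have fW: "finite W"
    unfolding W_def using U V V' by (intro finite_set_plus) (auto intro: finite_subset)
  show ?case
  proof (cases "real (card W) \<ge> (1 - e) * real (card V)")
    case True
    then show ?thesis using V' by (intro exI[of _ V']) (auto simp: W_def)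
  next
    case False
    then have Vpos: "card V > 0" by (cases "card V") auto
    have sum: "(\<Sum>v\<in>V. card {u\<in>U. u + v \<in> W}) \<le> card U * card W"
    proof -
      have "(\<Sum>v\<in>V. card {u\<in>U. u + v \<in> W}) = (\<Sum>v\<in>V. \<Sum>u\<in>U. if u + v \<in> W then 1 else 0)"
        using U by (simp add: sum.If_cases Int_def)
      also have "\<dots> = (\<Sum>u\<in>U. \<Sum>v\<in>V. if u + v \<in> W then 1 else 0)"
        by (rule sum.swap)
      also have "\<dots> = (\<Sum>u\<in>U. card {v\<in>V. u + v \<in> W})"
        using V by (simp add: sum.If_cases Int_def)
      also have "\<dots> \<le> (\<Sum>u\<in>U. card W)"
      proof (rule sum_mono)
        fix u
        show "card {v\<in>V. u + v \<in> W} \<le> card W"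
          by (rule card_inj_on_le[of "(+) u"]) (auto simp: fW)
      qed
      finally show ?thesis by simp
    qed
    have "\<exists>v\<in>V. real (card {u\<in>U. u + v \<in> W}) \<le> (1 - e) * real (card U)"
    proof (rule ccontr)
      assume "\<not> ?thesis"
      then have "\<And>v. v \<in> V \<Longrightarrow> (1 - e) * real (card U) < real (card {u\<in>U. u + v \<in> W})"
        by force
      then have "(\<Sum>v\<in>V. (1 - e) * real (card U)) < (\<Sum>v\<in>V. real (card {u\<in>U. u + v \<in> W}))"
        using Vpos V by (intro sum_strict_mono) auto
      also have "\<dots> \<le> real (card U * card W)" using sum of_nat_mono[OF sum, where ?'a=real] by simp
      also have "\<dots> \<le> real (card U) * ((1 - e) * real (card V))"
        using False by (simp add: mult_left_mono)
      finally show False by (simp add: mult.commute mult.left_commute)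
    qed
    then obtain v where v: "v \<in> V" "real (card {u\<in>U. u + v \<in> W}) \<le> (1 - e) * real (card U)" by blast
    define New where "New = (\<lambda>u. u + v) ` {u\<in>U. u + v \<notin> W}"
    have cN: "card New = card {u\<in>U. u + v \<notin> W}"
      unfolding New_def by (rule card_image) (auto simp: inj_on_def)
    have "card U = card {u\<in>U. u + v \<in> W} + card {u\<in>U. u + v \<notin> W}"
    proof -
      have "U = {u\<in>U. u + v \<in> W} \<union> {u\<in>U. u + v \<notin> W}" by auto
      moreover have "{u\<in>U. u + v \<in> W} \<inter> {u\<in>U. u + v \<notin> W} = {}" by auto
      ultimately show ?thesis using U
        by (metis (no_types, lifting) card_Un_disjoint finite_Un)
    qed
    then have N: "real (card New) \<ge> e * real (card U)"
      using v cN by (simp add: left_diff_distrib)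
    have sub: "W \<union> New \<subseteq> U + insert v V'"
      unfolding W_def New_def by (auto elim!: set_plus_elim intro: set_plus_intro)
    have "finite (U + insert v V')"
      using U V V' by (intro finite_set_plus) (auto intro: finite_subset)
    then have "card (W \<union> New) \<le> card (U + insert v V')" by (rule card_mono[OF _ sub])
    moreover have "card (W \<union> New) = card W + card New"
      using fW U by (intro card_Un_disjoint) (auto simp: New_def)
    ultimately have "real (card W) + e * real (card U) \<le> real (card (U + insert v V'))"
      using N by linarith
    moreover have "real M * e * real (card U) \<le> real (card W)"
      using V' False by (auto simp: W_def min_def split: if_splits)
    ultimately have "real (Suc M) * e * real (card U) \<le> real (card (U + insert v V'))"
      by (simp add: algebra_simps)
    moreover have "card (insert v V') \<le> Suc M"
      using V' card_insert_le_m1[of "Suc M" V' v] by simp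
    ultimately show ?thesis using V' v by (intro exI[of _ "insert v V'"]) auto
  qed
qed

section \<open>Covering by blocks and residue classes\<close>

text \<open>On one residue class the quotient \<open>(y - y0) div d\<close> is injective, with
  values in \<open>[0, l div d]\<close>.\<close>

lemma card_residue_class_le:
  fixes y0 l d \<rho> :: int
  assumes "d > 0" "l \<ge> 0"
  shows "real (card {y \<in> {y0..<y0+l}. y mod d = \<rho>}) \<le> of_int l / of_int d + 1"
proof -
  have "inj_on (\<lambda>y. (y - y0) div d) {y \<in> {y0..<y0+l}. y mod d = \<rho>}"
  proof (rule inj_onI)
    fix x y assume x: "x \<in> {y \<in> {y0..<y0+l}. y mod d = \<rho>}"
      and y: "y \<in> {y \<in> {y0..<y0+l}. y mod d = \<rho>}"
      and eq: "(x - y0) div d = (y - y0) div d"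
    have "(x - y0) mod d = (y - y0) mod d"
      using x y mod_diff_cong[of x d y y0 y0] by auto
    with eq have "x - y0 = y - y0" by (metis div_mult_mod_eq)
    then show "x = y" by simp
  qed
  moreover have "(\<lambda>y. (y - y0) div d) ` {y \<in> {y0..<y0+l}. y mod d = \<rho>} \<subseteq> {0..l div d}"
    using assms by (auto simp: pos_imp_zdiv_nonneg_iff intro!: zdiv_mono1)
  ultimately have "card {y \<in> {y0..<y0+l}. y mod d = \<rho>} \<le> card {0..l div d}"
    by (intro card_inj_on_le) auto
  also have "real (card {0..l div d}) = of_int (l div d) + 1"
    using assms by (simp add: pos_imp_zdiv_nonneg_iff)
  also have "of_int (l div d) \<le> (of_int l / of_int d :: real)"
    by (rule real_of_int_div4)
  finally show ?thesis by simp
qed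

text \<open>A uniformly random block of the window (one of \<open>N\<close>, of length \<open>d\<close>) together with a uniformly
  random residue class modulo \<open>d\<close> singles out, for each target \<open>s\<close>, one uniformly random
  representation \<open>s = u + (s - u)\<close> with \<open>u\<close> in the window.\<close>

lemma block_residue_cover_step:
  fixes X Y Z :: "int set" and d N w y0 l :: int and \<delta> :: real
  assumes d: "d > 0" and N: "N > 0" and Z: "finite Z" and l: "l \<ge> 0"
    and Y: "Y \<subseteq> {y0..<y0+l}"
    and bad: "\<And>s. s \<in> Z \<Longrightarrow> real (card {u \<in> {w..<w+d*N}. u \<notin> X \<or> s - u \<notin> Y}) \<le> \<delta> * of_int (d * N)"
  shows "\<exists>X'\<subseteq>X. \<exists>Y'\<subseteq>Y. finite X' \<and> finite Y' \<and> real (card X') \<le> of_int d \<and>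
           real (card Y') \<le> of_int l / of_int d + 1 \<and>
           real (card (Z - (X' + Y'))) \<le> \<delta> * real (card Z)"
proof -
  define P where "P = {0..<N} \<times> {0..<d}"
  define XB where "XB = (\<lambda>\<beta>. X \<inter> {w+\<beta>*d..<w+\<beta>*d+d})"
  define YR where "YR = (\<lambda>\<rho>. Y \<inter> {y \<in> {y0..<y0+l}. y mod d = \<rho>})"
  define miss where "miss = (\<lambda>q. Z - (XB (fst q) + YR (snd q)))"
  have finP: "finite P" by (simp add: P_def)
  have cP: "real (card P) = of_int (d * N)" using d N by (simp add: P_def)
  have per: "real (card {q\<in>P. s \<in> miss q}) \<le> \<delta> * of_int (d * N)" if s: "s \<in> Z" for s
  proof -
    define bd where "bd = {u \<in> {w..<w+d*N}. u \<notin> X \<or> s - u \<notin> Y}"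
    have fb: "finite bd" by (rule finite_subset[of _ "{w..<w+d*N}"]) (auto simp: bd_def)
    \<comment> \<open>Each pair (block, class) that misses \<open>s\<close> arises from some spoilt
      representation \<open>u\<close>, so the missing pairs are no more numerous than the spoilt
      \<open>u\<close>.\<close>
    have "{q\<in>P. s \<in> miss q} \<subseteq> (\<lambda>u. ((u - w) div d, (s - u) mod d)) ` bd"
    proof
      fix q assume q: "q \<in> {q\<in>P. s \<in> miss q}"
      obtain \<beta> \<rho> where q': "q = (\<beta>, \<rho>)" by (cases q)
      with q have \<beta>: "0 \<le> \<beta>" "\<beta> < N" and \<rho>: "0 \<le> \<rho>" "\<rho> < d"
        and ms: "s \<notin> XB \<beta> + YR \<rho>" by (auto simp: P_def miss_def)
      \<comment> \<open>The offset inside the block for which \<open>s - u\<close> falls into the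
        class \<open>\<rho>\<close>.\<close>
      define t where "t = (s - w - \<beta>*d - \<rho>) mod d"
      define u where "u = w + \<beta>*d + t"
      have t: "0 \<le> t" "t < d" using d by (auto simp: t_def)
      have "(s - u) mod d = (s - w - \<beta>*d - t) mod d" by (simp add: u_def algebra_simps)
      also have "\<dots> = (s - w - \<beta>*d - (s - w - \<beta>*d - \<rho>)) mod d"
        unfolding t_def by (rule mod_diff_right_eq)
      also have "\<dots> = \<rho>" using \<rho> by simp
      finally have m: "(s - u) mod d = \<rho>" .
      have "u - w = t + \<beta> * d" by (simp add: u_def)
      then have dv: "(u - w) div d = \<beta>" using t d by simp
      have "\<beta> * d + d \<le> d * N" 
        using \<beta> d mult_right_mono[of "\<beta> + 1" N d] by (simp add: algebra_simps)
      moreover have "0 \<le> \<beta> * d" using \<beta> d by simp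
      ultimately have "u \<in> {w..<w+d*N}" using t unfolding u_def by simp
      moreover have "u \<notin> X \<or> s - u \<notin> Y"
      proof (rule ccontr)
        assume c: "\<not> ?thesis"
        then have "u \<in> XB \<beta>" using t by (auto simp: XB_def u_def)
        moreover have "s - u \<in> YR \<rho>" using c m Y by (auto simp: YR_def)
        ultimately have "u + (s - u) \<in> XB \<beta> + YR \<rho>" by (rule set_plus_intro)
        then show False using ms by simp
      qed
      ultimately have "u \<in> bd" by (simp add: bd_def)
      then show "q \<in> (\<lambda>u. ((u - w) div d, (s - u) mod d)) ` bd"
        using m dv q' by (intro image_eqI[of _ _ u]) auto
    qed
    then have "card {q\<in>P. s \<in> miss q} \<le> card bd"
      using fb by (rule surj_card_le[rotated])
    then show ?thesis using bad[OF s] by (simp add: bd_def)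
  qed
  have fm: "finite (miss q)" for q using Z by (simp add: miss_def)
  \<comment> \<open>Counting the incidences (pair, missed target) in two ways: some pair does at
    least as well as the average.\<close>
  have "\<exists>q\<in>P. real (card (miss q)) \<le> \<delta> * real (card Z)"
  proof (rule ccontr)
    assume "\<not> ?thesis"
    then have "\<And>q. q \<in> P \<Longrightarrow> \<delta> * real (card Z) < real (card (miss q))" by force
    moreover have "P \<noteq> {}" using d N by (auto simp: P_def)
    ultimately have "(\<Sum>q\<in>P. \<delta> * real (card Z)) < (\<Sum>q\<in>P. real (card (miss q)))"
      using finP by (intro sum_strict_mono) auto
    also have "(\<Sum>q\<in>P. real (card (miss q))) = (\<Sum>q\<in>P. \<Sum>s\<in>Z. if s \<in> miss q then 1 else 0)"
    proof (rule sum.cong[OF refl])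
      fix q
      have "miss q = {s\<in>Z. s \<in> miss q}" by (auto simp: miss_def)
      then show "real (card (miss q)) = (\<Sum>s\<in>Z. if s \<in> miss q then 1 else 0)"
        using Z by (simp add: sum.If_cases Int_def)
    qed
    also have "\<dots> = (\<Sum>s\<in>Z. \<Sum>q\<in>P. if s \<in> miss q then 1 else 0)" by (rule sum.swap)
    also have "\<dots> = (\<Sum>s\<in>Z. real (card {q\<in>P. s \<in> miss q}))"
      using finP by (simp add: sum.If_cases Int_def)
    also have "\<dots> \<le> (\<Sum>s\<in>Z. \<delta> * of_int (d * N))" by (rule sum_mono) (rule per)
    finally show False using cP by (simp add: mult.commute mult.left_commute)
  qed
  then obtain \<beta> \<rho> where q: "real (card (Z - (XB \<beta> + YR \<rho>))) \<le> \<delta> * real (card Z)"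
    by (auto simp: miss_def)
  have "card (XB \<beta>) \<le> card {w+\<beta>*d..<w+\<beta>*d+d}" unfolding XB_def by (rule card_mono) auto
  then have "real (card (XB \<beta>)) \<le> of_int d" using d by simp
  moreover have "card (YR \<rho>) \<le> card {y \<in> {y0..<y0+l}. y mod d = \<rho>}"
    unfolding YR_def
    by (rule card_mono) (auto intro: finite_subset[of _ "{y0..<y0+l}"])
  then have "real (card (YR \<rho>)) \<le> of_int l / of_int d + 1"
    using card_residue_class_le[OF d l, of y0 \<rho>] by linarith
  moreover have "finite (XB \<beta>)" "finite (YR \<rho>)" "XB \<beta> \<subseteq> X" "YR \<rho> \<subseteq> Y"
    by (auto simp: XB_def YR_def intro: finite_subset[of _ "{y0..<y0+l}"])
  ultimately show ?thesis using q by blast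
qed

text \<open>Each round is applied only to the targets still missed. The loss is multiplied by
  \<open>\<delta>\<close> per round, whereas the numbers of summands merely add up.\<close>

lemma block_residue_cover:
  fixes X Y Z :: "int set" and d N w y0 l :: int and \<delta> :: real
  assumes d: "d > 0" and N: "N > 0" and Z: "finite Z" and l: "l \<ge> 0" and \<delta>: "\<delta> \<ge> 0"
    and Y: "Y \<subseteq> {y0..<y0+l}"
    and bad: "\<And>s. s \<in> Z \<Longrightarrow> real (card {u \<in> {w..<w+d*N}. u \<notin> X \<or> s - u \<notin> Y}) \<le> \<delta> * of_int (d * N)"
  shows "\<exists>X'\<subseteq>X. \<exists>Y'\<subseteq>Y. finite X' \<and> finite Y' \<and> real (card X') \<le> real K * of_int d \<and>
           real (card Y') \<le> real K * (of_int l / of_int d + 1) \<and>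
           real (card (Z - (X' + Y'))) \<le> \<delta> ^ K * real (card Z)"
proof (induction K)
  case 0
  show ?case by (rule exI[of _ "{}"], simp, rule exI[of _ "{}"]) (simp add: Z card_mono)
next
  case (Suc K)
  then obtain X1 Y1 where 1: "X1 \<subseteq> X" "Y1 \<subseteq> Y" "finite X1" "finite Y1" "real (card X1) \<le> real K * of_int d"
    "real (card Y1) \<le> real K * (of_int l / of_int d + 1)"
    "real (card (Z - (X1 + Y1))) \<le> \<delta> ^ K * real (card Z)" by blast
  define Z1 where "Z1 = Z - (X1 + Y1)"
  have "\<exists>X'\<subseteq>X. \<exists>Y'\<subseteq>Y. finite X' \<and> finite Y' \<and> real (card X') \<le> of_int d \<and>
           real (card Y') \<le> of_int l / of_int d + 1 \<and>
           real (card (Z1 - (X' + Y'))) \<le> \<delta> * real (card Z1)"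
    by (rule block_residue_cover_step[OF d N _ l Y]) (use Z bad in \<open>auto simp: Z1_def\<close>)
  then obtain X2 Y2 where 2: "X2 \<subseteq> X" "Y2 \<subseteq> Y" "finite X2" "finite Y2" "real (card X2) \<le> of_int d"
    "real (card Y2) \<le> of_int l / of_int d + 1"
    "real (card (Z1 - (X2 + Y2))) \<le> \<delta> * real (card Z1)" by blast
  have "Z - ((X1 \<union> X2) + (Y1 \<union> Y2)) \<subseteq> Z1 - (X2 + Y2)"
    unfolding Z1_def using set_plus_mono2[of X1 "X1 \<union> X2" Y1 "Y1 \<union> Y2"]
      set_plus_mono2[of X2 "X1 \<union> X2" Y2 "Y1 \<union> Y2"] by blast
  then have "card (Z - ((X1 \<union> X2) + (Y1 \<union> Y2))) \<le> card (Z1 - (X2 + Y2))"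
    using Z by (intro card_mono) (auto simp: Z1_def)
  then have "real (card (Z - ((X1 \<union> X2) + (Y1 \<union> Y2)))) \<le> \<delta> * real (card Z1)" using 2 by linarith
  also have "\<dots> \<le> \<delta> * (\<delta> ^ K * real (card Z))" using 1 \<delta> by (intro mult_left_mono) (auto simp: Z1_def)
  finally have "real (card (Z - ((X1 \<union> X2) + (Y1 \<union> Y2)))) \<le> \<delta> ^ Suc K * real (card Z)" by simp
  moreover have "real (card (X1 \<union> X2)) \<le> real (Suc K) * of_int d"
    using card_Un_le[of X1 X2] 1 2 by (simp add: distrib_right)
  moreover have "real (card (Y1 \<union> Y2)) \<le> real (Suc K) * (of_int l / of_int d + 1)"
  proof -
    have "real (Suc K) * (of_int l / of_int d + 1)
        = real K * (of_int l / of_int d + 1) + (of_int l / of_int d + 1 :: real)"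
      by (simp only: of_nat_Suc distrib_right mult_1_left add.commute)
    then show ?thesis using card_Un_le[of Y1 Y2] 1 2 by linarith
  qed
  moreover have "X1 \<union> X2 \<subseteq> X" "Y1 \<union> Y2 \<subseteq> Y" "finite (X1 \<union> X2)" "finite (Y1 \<union> Y2)" using 1 2 by auto
  ultimately show ?case by blast
qed

text \<open>For \<open>u\<close> in the window \<open>[w, w + S)\<close> and a target
  \<open>s\<close> in \<open>[z0, z1)\<close>, the partner \<open>s - u\<close> stays in
  \<open>[z0 - w - S + 1, z1 - w)\<close>. Hence at most \<open>h\<close> of the \<open>S\<close>
  representations of \<open>s\<close> are spoilt, uniformly in \<open>s\<close>.\<close>

lemma window_cover:
  fixes X Y Z :: "int set" and d N w z0 z1 :: int
  assumes d: "d > 0" and N: "N > 0" and S: "S = d * N" and Z: "Z \<subseteq> {z0..<z1}" and z: "z0 \<le> z1"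
    and h: "holes X w (w + S) + holes Y (z0 - w - S + 1) (z1 - w) \<le> h"
  shows "\<exists>X'\<subseteq>X. \<exists>Y'\<subseteq>Y. finite X' \<and> finite Y' \<and> real (card X') \<le> real K * of_int d \<and>
           real (card Y') \<le> real K * (of_int (z1 - z0 + S) / of_int d + 1) \<and>
           real (card (Z - (X' + Y'))) \<le> (h / of_int S) ^ K * real (card Z)"
proof -
  have Sp: "S > 0" using d N S by simp
  have h0: "0 \<le> h" using h holes_nonneg[of X w "w+S"] holes_nonneg[of Y "z0 - w - S + 1" "z1 - w"] by linarith
  \<comment> \<open>One below the least possible partner, so that the relevant part of
    \<open>Y\<close> sits in an interval of length exactly \<open>z1 - z0 + S\<close>.\<close>
  define y0 where "y0 = z0 - w - S"
  define Y1 where "Y1 = Y \<inter> {y0..<y0 + (z1 - z0 + S)}"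
  have "\<exists>X'\<subseteq>X. \<exists>Y'\<subseteq>Y1. finite X' \<and> finite Y' \<and> real (card X') \<le> real K * of_int d \<and>
           real (card Y') \<le> real K * (of_int (z1 - z0 + S) / of_int d + 1) \<and>
           real (card (Z - (X' + Y'))) \<le> (h / of_int S) ^ K * real (card Z)"
  proof (rule block_residue_cover[OF d N, where w = w and ?y0.0 = y0])
    show "finite Z" using Z finite_subset by blast
    show "z1 - z0 + S \<ge> 0" using z Sp by simp
    show "h / of_int S \<ge> 0" using h0 Sp by simp
    show "Y1 \<subseteq> {y0..<y0 + (z1 - z0 + S)}" by (auto simp: Y1_def)
    fix s assume s: "s \<in> Z"
    then have s': "z0 \<le> s" "s < z1" using Z by auto
    have "{u \<in> {w..<w+d*N}. u \<notin> X \<or> s - u \<notin> Y1}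
        \<subseteq> ({w..<w+S} - X) \<union> (\<lambda>y. s - y) ` ({z0 - w - S + 1..<z1 - w} - Y)"
    proof
      fix u assume u: "u \<in> {u \<in> {w..<w+d*N}. u \<notin> X \<or> s - u \<notin> Y1}"
      show "u \<in> ({w..<w+S} - X) \<union> (\<lambda>y. s - y) ` ({z0 - w - S + 1..<z1 - w} - Y)"
      proof (cases "u \<in> X")
        case True
        with u have "s - u \<notin> Y1" by auto
        moreover have "s - u \<in> {y0..<y0 + (z1 - z0 + S)}" using u s' by (auto simp: y0_def S)
        ultimately have "s - u \<notin> Y" by (auto simp: Y1_def)
        moreover have "s - u \<in> {z0 - w - S + 1..<z1 - w}" using u s' by (auto simp: S)
        ultimately have "u \<in> (\<lambda>y. s - y) ` ({z0 - w - S + 1..<z1 - w} - Y)"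
          by (intro image_eqI[of _ _ "s - u"]) auto
        then show ?thesis by simp
      qed (use u in \<open>auto simp: S\<close>)
    qed
    then have "card {u \<in> {w..<w+d*N}. u \<notin> X \<or> s - u \<notin> Y1}
        \<le> card (({w..<w+S} - X) \<union> (\<lambda>y. s - y) ` ({z0 - w - S + 1..<z1 - w} - Y))"
      by (intro card_mono) auto
    also have "\<dots> \<le> card ({w..<w+S} - X) + card ((\<lambda>y. s - y) ` ({z0 - w - S + 1..<z1 - w} - Y))"
      by (rule card_Un_le)
    also have "\<dots> \<le> card ({w..<w+S} - X) + card ({z0 - w - S + 1..<z1 - w} - Y)"
      by (simp add: card_image_le)
    finally have "real (card {u \<in> {w..<w+d*N}. u \<notin> X \<or> s - u \<notin> Y1}) \<le> h"
      using h by (simp add: holes_def)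
    also have "h = h / of_int S * of_int (d * N)" using Sp by (simp add: S[symmetric])
    finally show "real (card {u \<in> {w..<w+d*N}. u \<notin> X \<or> s - u \<notin> Y1}) \<le> h / of_int S * of_int (d * N)" .
  qed
  then show ?thesis unfolding Y1_def by blast
qed

section \<open>Covering from a nice pair\<close>

text \<open>A bound on a one-sided maximal function: the hole densities behind \<open>a\<close> and
  \<open>b\<close> together are at most \<open>1/32\<close> at every scale up to \<open>4 L\<close>.
  For positive \<open>L\<close>, the scale \<open>s = 1\<close> forces \<open>a\<close> into
  \<open>A\<close> and \<open>b\<close> into \<open>B\<close>.\<close>

definition nice :: "int set \<Rightarrow> int set \<Rightarrow> int \<Rightarrow> int \<Rightarrow> int \<Rightarrow> bool" where
  "nice A B L a b \<longleftrightarrow>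
     (\<forall>s. 1 \<le> s \<and> s \<le> 4 * L \<longrightarrow> 32 * (holes A a (a + s) + holes B b (b + s)) \<le> of_int s)"

lemma nice_commute: "nice A B L a b \<longleftrightarrow> nice B A L b a"
  by (simp add: nice_def add.commute)

lemma niceD: "nice A B L a b \<Longrightarrow> 0 \<le> s \<Longrightarrow> s \<le> 4 * L \<Longrightarrow>
    32 * holes A a (a + s) + 32 * holes B b (b + s) \<le> of_int s"
  by (cases "s = 0") (auto simp: nice_def distrib_left)

lemma card_diff_union_sumset_le:
  fixes X1 X2 Y1 Y2 Z :: "int set"
  assumes "finite Z"
  shows "card (Z - ((X1 \<union> X2) + (Y1 \<union> Y2))) \<le> card (Z - (X1 + Y1))"
    and "card (Z - ((X1 \<union> X2) + (Y1 \<union> Y2))) \<le> card (Z - (X2 + Y2))"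
  using assms set_plus_mono2[of X1 "X1 \<union> X2" Y1 "Y1 \<union> Y2"]
      set_plus_mono2[of X2 "X1 \<union> X2" Y2 "Y1 \<union> Y2"]
  by (auto intro!: card_mono)

lemma card_diff_Ivl_split_le:
  fixes S :: "int set"
  shows "card ({u..<w} - S) \<le> card ({u..<v} - S) + card ({v..<w} - S)"
proof -
  have "{u..<w} - S \<subseteq> ({u..<v} - S) \<union> ({v..<w} - S)" by auto
  then have "card ({u..<w} - S) \<le> card (({u..<v} - S) \<union> ({v..<w} - S))"
    by (intro card_mono) auto
  then show ?thesis using card_Un_le le_trans by blast
qed

text \<open>The targets at distance \<open>[4S, 16S)\<close> from \<open>a + b\<close> are covered from the window \<open>[S, 2S)\<close>
  using blocks of length \<open>\<surd>(S / R)\<close>. Each scale \<open>S = R 4\<^sup>j\<close> is charged to the holes at distance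
  \<open>[S, 16S)\<close>, so a hole is charged at most twice.\<close>

lemma forward_cover:
  fixes X Y :: "int set" and R L a b :: int and K :: nat
  assumes R: "R \<ge> 1" and K: "K \<ge> 1" and L: "L = R * 4 ^ J" and nice: "nice X Y L a b"
  shows "\<exists>X'\<subseteq>X. \<exists>Y'\<subseteq>Y. finite X' \<and> finite Y' \<and>
     real (card X') \<le> real K * 2 ^ J + 1 \<and>
     real (card Y') \<le> 14 * real K * of_int R * 2 ^ J + of_int R \<and>
     (\<forall>y\<in>Y \<inter> {b..<b+R}. a + y \<in> X' + Y') \<and>
     real (card ({a+b+R..<a+b+4*L} - (X' + Y'))) \<le>
       24 / 2 ^ K * ((holes X (a+R) (a+4*L) + holes Y (b+R) (b+4*L)) + (holes X (a+R) (a+L) + holes Y (b+R) (b+L)))"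
  using L nice
proof (induction J arbitrary: L)
  case 0
  then have LR: "L = R" by simp
  \<comment> \<open>At scale 1 niceness allows fewer than one hole, hence none.\<close>
  have aX: "a \<in> X" 
  proof -
    have "32 * holes X a (a+1) + 32 * holes Y b (b+1) \<le> 1"
      using niceD[OF 0(2), of 1] LR R by simp
    then have "holes X a (a+1) < 1" using holes_nonneg[of Y b "b+1"] by linarith
    then have "card ({a..<a+1} - X) = 0" by (simp add: holes_def)
    then show ?thesis by auto
  qed
  \<comment> \<open>The single translate \<open>a + Y\<close> covers everything except shifted holes
    of \<open>Y\<close>. Only these remain for the window \<open>[a, a + R)\<close>, used with
    blocks of length 1.\<close>
  define Z where "Z = {a+b+R..<a+b+4*R} - (\<lambda>y. a + y) ` Y"
  have cZ: "real (card Z) \<le> holes Y (b+R) (b+4*R)"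
  proof -
    have "Z \<subseteq> (\<lambda>y. a + y) ` ({b+R..<b+4*R} - Y)"
    proof
      fix z assume z: "z \<in> Z"
      then have "z - a \<in> {b+R..<b+4*R} - Y" by (force simp: Z_def image_iff)
      then show "z \<in> (\<lambda>y. a + y) ` ({b+R..<b+4*R} - Y)" by (intro image_eqI[of _ _ "z - a"]) auto
    qed
    then have "card Z \<le> card ({b+R..<b+4*R} - Y)" by (intro surj_card_le) auto
    then show ?thesis by (simp add: holes_def)
  qed
  have "\<exists>X'\<subseteq>X. \<exists>Y'\<subseteq>Y. finite X' \<and> finite Y' \<and> real (card X') \<le> real K * of_int 1 \<and>
           real (card Y') \<le> real K * (of_int ((a+b+4*R) - (a+b+R) + R) / of_int 1 + 1) \<and>
           real (card (Z - (X' + Y'))) \<le> ((of_int R / 8) / of_int R) ^ K * real (card Z)"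
  proof (rule window_cover[where w = a])
    have "holes X a (a+R) \<le> holes X a (a+4*R)" using R by (intro holes_mono) auto
    moreover have "holes Y (a + b + R - a - R + 1) (a + b + 4 * R - a) \<le> holes Y b (b + 4*R)"
      by (intro holes_mono) auto
    moreover have "32 * holes X a (a + 4*R) + 32 * holes Y b (b + 4*R) \<le> of_int (4*R)"
      using niceD[OF 0(2), of "4*R"] LR R by simp
    ultimately show "holes X a (a + R) + holes Y (a + b + R - a - R + 1) (a + b + 4 * R - a) \<le> of_int R / 8"
      by simp
  qed (use R in \<open>auto simp: Z_def\<close>)
  then obtain X1 Y1 where 1: "X1 \<subseteq> X" "Y1 \<subseteq> Y" "finite X1" "finite Y1" "real (card X1) \<le> real K"
      "real (card Y1) \<le> real K * (4 * of_int R + 1)"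
      "real (card (Z - (X1 + Y1))) \<le> (1 / 8) ^ K * real (card Z)" using R by auto
  define Y' where "Y' = Y1 \<union> Y \<inter> {b..<b+4*R}"
  have cov: "a + y \<in> insert a X1 + Y'" if "y \<in> Y" "y \<in> {b..<b+4*R}" for y
    using that by (intro set_plus_intro) (auto simp: Y'_def)
  have "{a+b+R..<a+b+4*L} - (insert a X1 + Y') \<subseteq> Z - (X1 + Y1)"
  proof
    fix z assume z: "z \<in> {a+b+R..<a+b+4*L} - (insert a X1 + Y')"
    have "z \<notin> X1 + Y1" using z set_plus_mono2[of X1 "insert a X1" Y1 Y'] by (auto simp: Y'_def)
    moreover have "z \<in> Z"
    proof (rule ccontr)
      assume "z \<notin> Z"
      then obtain y where y: "y \<in> Y" "z = a + y" using z LR by (auto simp: Z_def)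
      then have "y \<in> {b..<b+4*R}" using z LR R by auto
      with y cov z show False by auto
    qed
    ultimately show "z \<in> Z - (X1 + Y1)" by simp
  qed
  then have "card ({a+b+R..<a+b+4*L} - (insert a X1 + Y')) \<le> card (Z - (X1 + Y1))"
    by (intro card_mono) (auto simp: Z_def)
  then have "real (card ({a+b+R..<a+b+4*L} - (insert a X1 + Y'))) \<le> (1 / 8) ^ K * real (card Z)"
    using 1 by linarith
  also have "\<dots> \<le> (24 / 2 ^ K) * (holes Y (b+R) (b+4*R))"
  proof (rule mult_mono)
    have "(1 / 8 :: real) ^ K \<le> (1 / 2) ^ K" by (rule power_mono) auto
    also have "\<dots> \<le> 24 / 2 ^ K" by (simp add: power_one_over divide_right_mono)
    finally show "(1 / 8 :: real) ^ K \<le> 24 / 2 ^ K" .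
  qed (use cZ in auto)
  also have "\<dots> \<le> 24 / 2 ^ K * ((holes X (a+R) (a+4*L) + holes Y (b+R) (b+4*L)) + (holes X (a+R) (a+L) + holes Y (b+R) (b+L)))"
    using holes_nonneg[of X "a+R" "a+4*L"] LR by (intro mult_left_mono) auto
  finally have loss: "real (card ({a+b+R..<a+b+4*L} - (insert a X1 + Y'))) \<le> \<dots>" .
  have "card (Y \<inter> {b..<b+4*R}) \<le> card {b..<b+4*R}" by (rule card_mono) auto
  then have "real (card (Y \<inter> {b..<b+4*R})) \<le> 4 * of_int R" using R by simp
  moreover have "card Y' \<le> card Y1 + card (Y \<inter> {b..<b+4*R})" unfolding Y'_def by (rule card_Un_le)
  moreover have KR: "of_int R \<le> real K * of_int R" "real K \<le> real K * of_int R"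
    using R K by auto
  ultimately have "real (card Y') \<le> 14 * real K * of_int R + of_int R"
    using 1(6) by (simp add: distrib_left)
  moreover have "real (card (insert a X1)) \<le> real K + 1"
    using card_insert_le_m1[of "Suc (card X1)" X1 a] 1(5) by simp
  moreover have "insert a X1 \<subseteq> X" "Y' \<subseteq> Y" "finite (insert a X1)" "finite Y'"
    using 1 aX by (auto simp: Y'_def)
  moreover have "\<forall>y\<in>Y \<inter> {b..<b+R}. a + y \<in> insert a X1 + Y'" using cov R by auto
  ultimately show ?case using loss by (intro exI[of _ "insert a X1"] conjI exI[of _ Y']) auto
next
  case (Suc J)
  define S where "S = R * 4 ^ J"
  have S4: "L = 4 * S" using Suc.prems by (simp add: S_def)
  have p4: "(1::int) \<le> 4 ^ J" by simp
  have RS: "R \<le> S" using R mult_left_mono[OF p4, of R] by (simp add: S_def)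
  have nS: "nice X Y S a b" using Suc.prems(2) RS R unfolding nice_def S4 by auto
  from Suc.IH[OF S_def nS] obtain X1 Y1 where 1: "X1 \<subseteq> X" "Y1 \<subseteq> Y" "finite X1" "finite Y1"
     "real (card X1) \<le> real K * 2 ^ J + 1"
     "real (card Y1) \<le> 14 * real K * of_int R * 2 ^ J + of_int R"
     "\<forall>y\<in>Y \<inter> {b..<b+R}. a + y \<in> X1 + Y1"
     "real (card ({a+b+R..<a+b+4*S} - (X1 + Y1))) \<le>
       24 / 2 ^ K * ((holes X (a+R) (a+4*S) + holes Y (b+R) (b+4*S)) + (holes X (a+R) (a+S) + holes Y (b+R) (b+S)))"
    by blast
  define h where "h = holes X (a+S) (a+16*S) + holes Y (b+S) (b+16*S)"
  have h0: "0 \<le> h" by (simp add: h_def)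
  have hS: "h \<le> of_int S / 2"
  proof -
    have "32 * holes X a (a+16*S) + 32 * holes Y b (b+16*S) \<le> of_int (16*S)"
      using niceD[OF Suc.prems(2), of "16*S"] RS R S4 by simp
    moreover have "holes X (a+S) (a+16*S) \<le> holes X a (a+16*S)"
      "holes Y (b+S) (b+16*S) \<le> holes Y b (b+16*S)" using RS R by (auto intro!: holes_mono)
    ultimately show ?thesis by (simp add: h_def)
  qed
  \<comment> \<open>Blocks of length \<open>2 ^ J\<close>, of which the window holds
    \<open>R * 2 ^ J\<close>. Both costs double with each scale, so the sum over all scales is of
    the order of the last one.\<close>
  have SN: "S = 2 ^ J * (R * 2 ^ J)"
  proof -
    have "(4::int) ^ J = 2 ^ J * 2 ^ J" by (simp flip: power_mult_distrib)
    then show ?thesis by (simp add: S_def)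
  qed
  have "\<exists>X'\<subseteq>X. \<exists>Y'\<subseteq>Y. finite X' \<and> finite Y' \<and> real (card X') \<le> real K * of_int (2 ^ J) \<and>
           real (card Y') \<le> real K * (of_int ((a+b+16*S) - (a+b+4*S) + S) / of_int (2 ^ J) + 1) \<and>
           real (card ({a+b+4*S..<a+b+16*S} - (X' + Y'))) \<le> (h / of_int S) ^ K * real (card {a+b+4*S..<a+b+16*S})"
  proof (rule window_cover[OF _ _ SN, where w = "a + S"])
    have "holes X (a+S) (a+S+S) \<le> holes X (a+S) (a+16*S)" using RS R by (intro holes_mono) auto
    moreover have "holes Y (a + b + 4 * S - (a + S) - S + 1) (a + b + 16 * S - (a + S)) \<le> holes Y (b+S) (b + 16*S)"
      using RS R by (intro holes_mono) auto
    ultimately show "holes X (a+S) (a + S + S) + holes Y (a + b + 4 * S - (a + S) - S + 1) (a + b + 16 * S - (a + S)) \<le> h"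
      by (simp add: h_def)
  qed (use R RS in auto)
  then obtain X2 Y2 where 2: "X2 \<subseteq> X" "Y2 \<subseteq> Y" "finite X2" "finite Y2" "real (card X2) \<le> real K * 2 ^ J"
      "real (card Y2) \<le> real K * (13 * of_int S / 2 ^ J + 1)"
      "real (card ({a+b+4*S..<a+b+16*S} - (X2 + Y2))) \<le> (h / of_int S) ^ K * (12 * of_int S)"
    using RS R by auto
  have Sp: "(0::real) < of_int S" using RS R by simp
  \<comment> \<open>One of the \<open>K\<close> factors \<open>h / S\<close> cancels the number
    \<open>12 S\<close> of targets, which makes the loss proportional to \<open>h\<close>. The other
    factors are at most \<open>1/2\<close>.\<close>
  have l2: "(h / of_int S) ^ K * (12 * of_int S) \<le> 24 / 2 ^ K * h"
  proof -
    obtain K' where K': "K = Suc K'" using K by (cases K) auto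
    have "(h / of_int S) ^ K * (12 * of_int S) = (h / of_int S) ^ K' * (12 * h)"
      using Sp K' by (simp add: field_simps)
    also have "\<dots> \<le> (1 / 2) ^ K' * (12 * h)"
      using Sp h0 hS by (intro mult_right_mono power_mono) (auto simp: field_simps)
    also have "\<dots> = 24 / 2 ^ K * h" using K' by (simp add: power_one_over field_simps)
    finally show ?thesis .
  qed
  define S' where "S' = (X1 \<union> X2) + (Y1 \<union> Y2)"
  have "card ({a+b+R..<a+b+4*L} - S') \<le> card ({a+b+R..<a+b+4*S} - S') + card ({a+b+4*S..<a+b+4*L} - S')"
    by (rule card_diff_Ivl_split_le)
  also have "\<dots> \<le> card ({a+b+R..<a+b+4*S} - (X1 + Y1)) + card ({a+b+4*S..<a+b+4*L} - (X2 + Y2))"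
    unfolding S'_def by (intro add_mono card_diff_union_sumset_le) auto
  finally have "real (card ({a+b+R..<a+b+4*L} - S')) \<le> 24 / 2 ^ K * ((holes X (a+R) (a+4*S) + holes Y (b+R) (b+4*S)) + (holes X (a+R) (a+S) + holes Y (b+R) (b+S))) + 24 / 2 ^ K * h"
    using 1(8) 2(7) l2 S4 by simp
  also have "\<dots> = 24 / 2 ^ K * (((holes X (a+R) (a+4*S) + holes Y (b+R) (b+4*S)) + (holes X (a+R) (a+S) + holes Y (b+R) (b+S))) + h)"
    by (simp only: distrib_left)
  \<comment> \<open>The new charge on \<open>[S, 16 S)\<close> extends the old charge on
    \<open>[R, S)\<close> to \<open>[R, 4 L)\<close>, and the old charge on \<open>[R, 4 S)\<close>
    is the new one on \<open>[R, L)\<close>.\<close>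
  also have "((holes X (a+R) (a+4*S) + holes Y (b+R) (b+4*S)) + (holes X (a+R) (a+S) + holes Y (b+R) (b+S))) + h
      = (holes X (a+R) (a+4*L) + holes Y (b+R) (b+4*L)) + (holes X (a+R) (a+L) + holes Y (b+R) (b+L))"
  proof -
    have "holes A (c+R) (c+16*S) = holes A (c+R) (c+S) + holes A (c+S) (c+16*S)" for A c
      using RS R by (intro holes_split) auto
    then show ?thesis by (simp add: h_def S4)
  qed
  finally have loss: "real (card ({a+b+R..<a+b+4*L} - S')) \<le> 24 / 2 ^ K *
    ((holes X (a+R) (a+4*L) + holes Y (b+R) (b+4*L)) + (holes X (a+R) (a+L) + holes Y (b+R) (b+L)))" .
  have cX: "real (card (X1 \<union> X2)) \<le> real K * 2 ^ Suc J + 1"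
    using card_Un_le[of X1 X2] 1(5) 2(5) by simp
  have SJ: "of_int S / 2 ^ J = (of_int R * 2 ^ J :: real)" using SN by simp
  have "1 \<le> of_int R * (2 ^ J :: real)" using R mult_mono[of 1 "of_int R :: real" 1 "2^J"] by simp
  then have "13 * of_int S / 2 ^ J + 1 \<le> 14 * (of_int R * (2 ^ J :: real))" using SJ by simp
  then have "real K * (13 * of_int S / 2 ^ J + 1) \<le> real K * (14 * (of_int R * 2 ^ J))"
    by (intro mult_left_mono) auto
  then have cY: "real (card (Y1 \<union> Y2)) \<le> 14 * real K * of_int R * 2 ^ Suc J + of_int R"
    using card_Un_le[of Y1 Y2] 1(6) 2(6) by (simp add: algebra_simps)
  have "X1 + Y1 \<subseteq> S'" unfolding S'_def by (intro set_plus_mono2) auto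
  then have "\<forall>y\<in>Y \<inter> {b..<b+R}. a + y \<in> S'" using 1(7) by blast
  then show ?case using loss cX cY 1 2 unfolding S'_def
    by (intro exI[of _ "X1 \<union> X2"] conjI exI[of _ "Y1 \<union> Y2"]) auto
qed

section \<open>Collecting the sums at an end\<close>

text \<open>Take \<open>u = min |U| k1\<close> elements of \<open>U\<close> and add greedily chosen
  elements of \<open>V\<close>. If \<open>U\<close> is small then \<open>u \<ge> e * r\<close>, and
  boundedly many suffice; otherwise \<open>u = k1\<close>, and a constant times
  \<open>r / k1 \<le> k2\<close> suffice.\<close>

lemma balanced_sumset:
  fixes U V :: "int set" and r e :: real and k1 k2 :: nat
  assumes U: "finite U" and V: "finite V" and e: "0 < e" "e \<le> 1" and r: "0 < r"
    and rk: "r \<le> real k1 * real k2" and cU: "e * r \<le> real (card U)" and cV: "real (card V) \<le> 2 * r"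
  shows "\<exists>U'\<subseteq>U. \<exists>V'\<subseteq>V. real (card U') \<le> real k1 \<and> real (card V') \<le> (2 / e\<^sup>2 + 1) * real k2 \<and>
           (1 - e) * real (card V) \<le> real (card (U' + V'))"
proof -
  have k: "k1 > 0" "k2 > 0" using r rk by (auto intro!: Nat.gr0I)
  define u where "u = min (card U) k1"
  obtain U' where U': "U' \<subseteq> U" "card U' = u"
    using obtain_subset_with_card_n[of u U] by (auto simp: u_def)
  have up: "real u > 0"
  proof -
    have "0 < e * r" using e r by simp
    then have "card U > 0" using cU by linarith
    then show ?thesis using k by (simp add: u_def)
  qed
  \<comment> \<open>Chosen so that \<open>M * e * u \<ge> 2 * r \<ge> |V|\<close>, whence the first
    term of the minimum in \<open>greedy_sumset\<close> is the smaller one.\<close>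
  define M where "M = nat \<lceil>2 * r / (e * real u)\<rceil>"
  have q0: "0 < 2 * r / (e * real u)" using r e up by simp
  have Mge: "2 * r / (e * real u) \<le> real M" unfolding M_def by (rule real_nat_ceiling_ge)
  have Mle: "real M \<le> 2 * r / (e * real u) + 1" unfolding M_def using q0 by linarith
  have "2 * r / (e * real u) \<le> 2 / e\<^sup>2 * real k2"
  proof (cases "card U \<le> k1")
    case True
    then have "e * r \<le> real u" using cU by (simp add: u_def)
    then have "2 * r / (e * real u) \<le> 2 * r / (e * (e * r))"
      using e r up by (intro divide_left_mono mult_left_mono) auto
    also have "\<dots> = 2 / e\<^sup>2" using r by (simp add: power2_eq_square)
    also have "\<dots> \<le> 2 / e\<^sup>2 * real k2" using e k mult_left_mono[of 1 "real k2" "2 / e\<^sup>2"] by simp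
    finally show ?thesis .
  next
    case False
    then have "2 * r / (e * real u) = (2 / e) * (r / real k1)" by (simp add: u_def)
    also have "\<dots> \<le> (2 / e) * real k2"
      using e k rk by (intro mult_left_mono) (auto simp: field_simps)
    also have "\<dots> \<le> 2 / e\<^sup>2 * real k2"
    proof (rule mult_right_mono)
      have "e * e \<le> e * 1" using e by (intro mult_left_mono) auto
      then show "2 / e \<le> 2 / e\<^sup>2" using e by (auto simp: power2_eq_square intro!: divide_left_mono)
    qed simp
    finally show ?thesis .
  qed
  then have M: "real M \<le> (2 / e\<^sup>2 + 1) * real k2"
    using Mle k by (simp add: distrib_right)
  have "finite U'" using U' U finite_subset by blast
  from greedy_sumset[OF this V, of e M] e obtain V' where V': "V' \<subseteq> V" "card V' \<le> M"
    "min ((1 - e) * real (card V)) (real M * e * real u) \<le> real (card (U' + V'))"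
    using U' by auto
  have "2 * r \<le> real M * e * real u" using Mge e up by (simp add: field_simps)
  moreover have "(1 - e) * real (card V) \<le> 1 * real (card V)" using e by (intro mult_right_mono) auto
  ultimately have "(1 - e) * real (card V) \<le> real (card (U' + V'))" using V' cV by simp
  moreover have "real (card V') \<le> (2 / e\<^sup>2 + 1) * real k2" using V' M by linarith
  moreover have "real (card U') \<le> real k1" using U' by (simp add: u_def)
  ultimately show ?thesis using U' V' by blast
qed

text \<open>The sums are split at \<open>a + b + r - p\<close>: below it, the few elements of \<open>A\<close> in front of \<open>a - p + e\<close> are
  added to \<open>B \<inter> [0, b + r - e)\<close>; above it, the few elements of \<open>B\<close> behind \<open>b\<close> are added to
  \<open>A \<inter> [a + r - p, a + r - e)\<close>. In total this collects \<open>|B \<inter> [0, b + r)|\<close> and \<open>|A \<inter> [a + r - p, a + r)|\<close>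
  up to a small error.\<close>

lemma two_sided_collect:
  fixes A B :: "int set" and a b r p f :: int and \<epsilon> :: real and k1 k2 :: nat
  assumes \<epsilon>: "0 < \<epsilon>" "\<epsilon> \<le> 1 / 2" and f: "f = \<lceil>\<epsilon> * of_int r\<rceil>" and e: "e = 2 * (f - 1)"
    and r: "1 \<le> r" and ab: "0 \<le> a" "0 \<le> b" and p: "0 \<le> p" "p \<le> r"
    and rk: "of_int r \<le> real k1 * real k2"
    and T: "real (card (A \<inter> {0..<a})) + real (card (B \<inter> {0..<b})) \<le> of_int r"
    and cA: "of_int f \<le> real (card (A \<inter> {0..<a-p+e+1}))"
    and cB: "of_int f \<le> real (card (B \<inter> {b..<b+e+1}))"
    and gain: "real (card (A \<inter> {0..<a})) + 8 * \<epsilon> * of_int r \<le> of_int p + holes A a (a+r-p)"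
  shows "\<exists>A'\<subseteq>A. \<exists>B'\<subseteq>B. finite A' \<and> finite B' \<and>
     real (card A') \<le> (2 / \<epsilon>\<^sup>2 + 2) * real k1 \<and> real (card B') \<le> (2 / \<epsilon>\<^sup>2 + 2) * real k2 \<and>
     real (card (A \<inter> {0..<a})) + real (card (B \<inter> {0..<b})) + of_int r
       - (holes A a (a+r) + holes B b (b+r)) + \<epsilon> * of_int r \<le> real (card ((A' + B') \<inter> {0..<a+b+r}))"
proof -
  have er0: "0 < \<epsilon> * of_int r" using \<epsilon> r by simp
  have f1: "1 \<le> f" using er0 f by linarith
  have fr: "\<epsilon> * of_int r \<le> of_int f" "of_int f < \<epsilon> * of_int r + 1" using f by linarith+
  have er: "of_int e < 2 * (\<epsilon> * of_int r)" using e fr by simp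
  have "\<epsilon> * of_int r \<le> 1/2 * of_int r" using \<epsilon> r by (intro mult_right_mono) auto
  then have "real_of_int e < of_int r" using er by linarith
  then have e_r: "e < r" "0 \<le> e" using e f1 by auto
  \<comment> \<open>The cut-offs make \<open>a + b + r - p - 1\<close> the largest possible sum of
    \<open>U\<close> and \<open>V\<close>, and put the sums of \<open>U2\<close> and
    \<open>V2\<close> into \<open>[a + b + r - p, a + b + r)\<close>; so the two sumsets are
    disjoint.\<close>
  define U where "U = A \<inter> {0..<a-p+e+1}"
  define V where "V = B \<inter> {0..<b+r-e}"
  define U2 where "U2 = B \<inter> {b..<b+e+1}"
  define V2 where "V2 = A \<inter> {a+r-p..<a+r-e}"
  have cV: "real (card V) = real (card (B \<inter> {0..<b})) + (of_int (r - e) - holes B b (b+r-e))"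
    using card_Int_split[of 0 b "b+r-e" B] holes_plus_card[of b "b+r-e" B] ab e_r by (simp add: V_def)
  have "holes B b (b+r-e) \<le> holes B b (b+r)" using e_r by (intro holes_mono) auto
  then have cVge: "real (card V) \<ge> real (card (B \<inter> {0..<b})) + of_int r - of_int e - holes B b (b+r)"
    using cV by simp
  have cVle: "real (card V) \<le> 2 * of_int r" using cV T e_r holes_nonneg[of B b "b+r-e"] unfolding of_int_diff by linarith
  have cV2: "real (card V2) \<le> of_int r \<and> of_int p - of_int e - holes A (a+r-p) (a+r) \<le> real (card V2)"
  proof (cases "e \<le> p")
    case True
    have "holes A (a+r-p) (a+r-e) \<le> holes A (a+r-p) (a+r)" using e_r by (intro holes_mono) auto
    then show ?thesis using holes_plus_card[of "a+r-p" "a+r-e" A] True p e_r holes_nonneg[of A "a+r-p" "a+r-e"]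
      unfolding V2_def of_int_diff of_int_add by (intro conjI; linarith)
  next
    case False
    then have "V2 = {}" by (auto simp: V2_def)
    then have "real (card V2) = 0" by simp
    then show ?thesis using False r holes_nonneg[of A "a+r-p" "a+r"] by (intro conjI; linarith)
  qed
  have hA: "holes A a (a+r) = holes A a (a+r-p) + holes A (a+r-p) (a+r)"
    using p by (intro holes_split) auto
  have "\<exists>U'\<subseteq>U. \<exists>V'\<subseteq>V. real (card U') \<le> real k1 \<and> real (card V') \<le> (2 / \<epsilon>\<^sup>2 + 1) * real k2 \<and>
           (1 - \<epsilon>) * real (card V) \<le> real (card (U' + V'))"
    by (rule balanced_sumset[where r = "of_int r"])
       (use \<epsilon> r rk cVle cA fr in \<open>auto simp: U_def V_def\<close>)
  then obtain U' V' where 1: "U' \<subseteq> U" "V' \<subseteq> V" "real (card U') \<le> real k1"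
    "real (card V') \<le> (2 / \<epsilon>\<^sup>2 + 1) * real k2" "(1 - \<epsilon>) * real (card V) \<le> real (card (U' + V'))" by blast
  have "\<exists>U'\<subseteq>U2. \<exists>V'\<subseteq>V2. real (card U') \<le> real k2 \<and> real (card V') \<le> (2 / \<epsilon>\<^sup>2 + 1) * real k1 \<and>
           (1 - \<epsilon>) * real (card V2) \<le> real (card (U' + V'))"
    by (rule balanced_sumset[where r = "of_int r"])
       (use \<epsilon> r rk cV2 cB fr in \<open>auto simp: U2_def V2_def mult.commute\<close>)
  then obtain U2' V2' where 2: "U2' \<subseteq> U2" "V2' \<subseteq> V2" "real (card U2') \<le> real k2"
    "real (card V2') \<le> (2 / \<epsilon>\<^sup>2 + 1) * real k1" "(1 - \<epsilon>) * real (card V2) \<le> real (card (U2' + V2'))" by blast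
  define A' where "A' = U' \<union> V2'"
  define B' where "B' = V' \<union> U2'"
  have sub: "A' \<subseteq> A" "B' \<subseteq> B" using 1 2 by (auto simp: A'_def B'_def U_def V_def U2_def V2_def)
  have fin: "finite U'" "finite V'" "finite U2'" "finite V2'"
    using 1 2 by (auto simp: U_def V_def U2_def V2_def intro: finite_subset)
  have s1: "U' + V' \<subseteq> {0..<a+b+r-p}"
  proof
    fix x assume "x \<in> U' + V'"
    then obtain u v where "x = u + v" "u \<in> U" "v \<in> V" using 1 by (auto elim!: set_plus_elim)
    then show "x \<in> {0..<a+b+r-p}" by (auto simp: U_def V_def)
  qed
  have s2: "U2' + V2' \<subseteq> {a+b+r-p..<a+b+r}"
  proof
    fix x assume "x \<in> U2' + V2'"
    then obtain u v where "x = u + v" "u \<in> U2" "v \<in> V2" using 2 by (auto elim!: set_plus_elim)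
    then show "x \<in> {a+b+r-p..<a+b+r}" by (auto simp: U2_def V2_def)
  qed
  have "U' + V' \<subseteq> A' + B'" unfolding A'_def B'_def by (intro set_plus_mono2) auto
  moreover have "V2' + U2' \<subseteq> A' + B'" unfolding A'_def B'_def by (intro set_plus_mono2) auto
  then have "U2' + V2' \<subseteq> A' + B'" by (simp add: add.commute)
  ultimately have "(U' + V') \<union> (U2' + V2') \<subseteq> (A' + B') \<inter> {0..<a+b+r}"
    using s1 s2 ab p by fastforce
  then have "card ((U' + V') \<union> (U2' + V2')) \<le> card ((A' + B') \<inter> {0..<a+b+r})"
    by (intro card_mono) auto
  moreover have "card ((U' + V') \<union> (U2' + V2')) = card (U' + V') + card (U2' + V2')"
  proof (rule card_Un_disjoint)
    show "(U' + V') \<inter> (U2' + V2') = {}" using s1 s2 by fastforce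
  qed (use s1 s2 finite_subset in blast)+
  ultimately have "(1 - \<epsilon>) * real (card V) + (1 - \<epsilon>) * real (card V2) \<le> real (card ((A' + B') \<inter> {0..<a+b+r}))"
    using 1(5) 2(5) by linarith
  moreover have "\<epsilon> * real (card V) \<le> 2 * (\<epsilon> * of_int r)" 
    using mult_left_mono[OF cVle, of \<epsilon>] \<epsilon> by simp
  moreover have "\<epsilon> * real (card V2) \<le> \<epsilon> * of_int r"
    using mult_left_mono[OF conjunct1[OF cV2], of \<epsilon>] \<epsilon> by simp
  \<comment> \<open>The budget: the truncations by \<open>e\<close> cost less than
    \<open>4 \<epsilon> r\<close>, the two factors \<open>1 - \<epsilon>\<close> at most
    \<open>3 \<epsilon> r\<close>. The \<open>8 \<epsilon> r\<close> granted by \<open>gain\<close>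
    therefore leave a surplus of \<open>\<epsilon> r\<close>.\<close>
  ultimately have "real (card (A \<inter> {0..<a})) + real (card (B \<inter> {0..<b})) + of_int r
       - (holes A a (a+r) + holes B b (b+r)) + \<epsilon> * of_int r \<le> real (card ((A' + B') \<inter> {0..<a+b+r}))"
    using cVge cV2 gain er hA unfolding left_diff_distrib by simp
  moreover have "real (card A') \<le> (2 / \<epsilon>\<^sup>2 + 2) * real k1"
    using card_Un_le[of U' V2'] 1(3) 2(4) unfolding A'_def distrib_right by simp
  moreover have "real (card B') \<le> (2 / \<epsilon>\<^sup>2 + 2) * real k2"
    using card_Un_le[of V' U2'] 1(4) 2(3) unfolding B'_def distrib_right by simp
  ultimately show ?thesis using sub fin unfolding A'_def B'_def by blast
qed

section \<open>Collecting with a surplus, and descent to a suitable nice pair\<close>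

abbreviation eps :: real where "eps \<equiv> 1 / 1000000"

text \<open>Equivalently, \<open>A' + B'\<close> misses at most
  \<open>holes A 0 (a+r) + holes B 0 (b+r) - eps * r\<close> points of
  \<open>[0, a + b + r)\<close>, if \<open>a\<close>, \<open>b\<close>, \<open>r\<close> are
  nonnegative. The surplus \<open>eps * r\<close> later pays for the forward cover.\<close>

definition collects :: "int set \<Rightarrow> int set \<Rightarrow> nat \<Rightarrow> nat \<Rightarrow> int \<Rightarrow> int \<Rightarrow> int \<Rightarrow> bool" where
  "collects A B k1 k2 a b r \<longleftrightarrow> (\<exists>A'\<subseteq>A. \<exists>B'\<subseteq>B. finite A' \<and> finite B' \<and>
     real (card A') \<le> (2 / eps\<^sup>2 + 2) * real k1 \<and> real (card B') \<le> (2 / eps\<^sup>2 + 2) * real k2 \<and>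
     real (card (A \<inter> {0..<a})) + real (card (B \<inter> {0..<b})) + of_int r
       - (holes A a (a+r) + holes B b (b+r)) + eps * of_int r \<le> real (card ((A' + B') \<inter> {0..<a+b+r})))"

lemma collects_commute: "collects A B k1 k2 a b r \<longleftrightarrow> collects B A k2 k1 b a r"
proof -
  have "collects B A k2 k1 b a r" if "collects A B k1 k2 a b r" for A B k1 k2 a b r
  proof -
    from that obtain A' B' where "A' \<subseteq> A" "B' \<subseteq> B" "finite A'" "finite B'"
      "real (card A') \<le> (2 / eps\<^sup>2 + 2) * real k1" "real (card B') \<le> (2 / eps\<^sup>2 + 2) * real k2"
      "real (card (A \<inter> {0..<a})) + real (card (B \<inter> {0..<b})) + of_int r
       - (holes A a (a+r) + holes B b (b+r)) + eps * of_int r \<le> real (card ((A' + B') \<inter> {0..<a+b+r}))"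
      unfolding collects_def by blast
    then show ?thesis unfolding collects_def
      by (intro exI[of _ B'] conjI exI[of _ A']) (auto simp: add.commute[of B' A'] add.commute[of b a])
  qed
  then show ?thesis by blast
qed

lemma card_Int_le_add_length:
  fixes A :: "int set"
  assumes "q \<le> a"
  shows "real (card (A \<inter> {u..<a})) \<le> real (card (A \<inter> {u..<q})) + of_int (a - q)"
proof -
  have "A \<inter> {u..<a} \<subseteq> A \<inter> {u..<q} \<union> {q..<a}" by auto
  then have "card (A \<inter> {u..<a}) \<le> card (A \<inter> {u..<q} \<union> {q..<a})" by (intro card_mono) auto
  also have "\<dots> \<le> card (A \<inter> {u..<q}) + card {q..<a}" by (rule card_Un_le)
  finally show ?thesis using assms by simp
qed

lemma real_less_imp_le_minus_one:
  assumes "real n < of_int f"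
  shows "real n \<le> of_int f - 1"
proof -
  have "real_of_int (int n) < of_int f" using assms by simp
  then have "int n \<le> f - 1" by (simp only: of_int_less_iff)
  then have "real_of_int (int n) \<le> of_int (f - 1)" by (simp only: of_int_le_iff)
  then show ?thesis by simp
qed

text \<open>Apply \<open>two_sided_collect\<close> with the least \<open>p\<close> that satisfies
  its hypothesis \<open>gain\<close>. Niceness supplies the elements of \<open>B\<close>, so failure
  means that \<open>A\<close> has fewer than \<open>f\<close> elements below
  \<open>a - p + e + 1\<close>. Then nearly all of the \<open>p\<close> places in front of
  \<open>a\<close> are needed to hold \<open>|A \<inter> [0, a)|\<close> elements, and minimality of
  \<open>p\<close> leaves little room for holes behind \<open>a\<close>.\<close>

lemma not_collects_imp_full:
  fixes A B :: "int set" and L a b r f e :: int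
  assumes nice: "nice A B L a b" and ab: "0 \<le> a" "0 \<le> b"
    and T: "8 * (real (card (A \<inter> {0..<a})) + real (card (B \<inter> {0..<b}))) \<le> of_int r"
    and r: "8 \<le> r" "2 * r \<le> L" and rk: "of_int r \<le> real k1 * real k2"
    and f: "f = \<lceil>eps * of_int r\<rceil>" and e: "e = 2 * (f - 1)"
    and fail: "\<not> collects A B k1 k2 a b r"
  shows "\<exists>p. 1 \<le> p \<and> of_int p + holes A a (a+r-p) < real (card (A \<inter> {0..<a})) + 8 * eps * of_int r + 1 \<and>
     real (card (A \<inter> {0..<a-p+e+1})) < of_int f \<and> holes A a (a+r-p) \<le> 8 * eps * of_int r"
proof -
  define TA where "TA = real (card (A \<inter> {0..<a}))"
  have TA: "0 \<le> TA" "8 * TA \<le> of_int r" using T unfolding TA_def by auto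
  have f1: "1 \<le> f" using r f by linarith
  have fr: "eps * of_int r \<le> of_int f" "of_int f < eps * of_int r + 1" using f by linarith+
  have e0: "0 \<le> e" using e f1 by simp
  have "real_of_int (e + 1) \<le> of_int (4 * L)" using fr e r by simp
  then have eL: "e + 1 \<le> 4 * L" by (simp only: of_int_le_iff)
  define P where "P = (\<lambda>n::nat. TA + 8 * eps * of_int r \<le> real n + holes A a (a + r - int n))"
  define p0 where "p0 = nat \<lceil>TA + 8 * eps * of_int r\<rceil>"
  have P0: "P p0"
  proof -
    have "TA + 8 * eps * of_int r \<le> real p0" unfolding p0_def by linarith
    then show ?thesis unfolding P_def using holes_nonneg[of A a "a + r - int p0"] by linarith
  qed
  define n where "n = (LEAST n. P n)"
  have Pn: "P n" unfolding n_def using P0 by (rule LeastI)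
  have np0: "n \<le> p0" unfolding n_def using P0 by (rule Least_le)
  have "real p0 \<le> of_int r" unfolding p0_def using TA r by linarith
  then have nr: "int n \<le> r" using np0 by linarith
  \<comment> \<open>This explains \<open>e = 2 * (f - 1)\<close>: at least \<open>31/32\<close> of
    the \<open>2 f - 1\<close> places lie in \<open>B\<close>, which by integrality gives at least
    \<open>f\<close> elements. For small \<open>r\<close> one has \<open>f = 1\<close> and
    \<open>e = 0\<close>, so nothing is truncated.\<close>
  have cB: "of_int f \<le> real (card (B \<inter> {b..<b+e+1}))"
  proof -
    have "32 * holes A a (a+(e+1)) + 32 * holes B b (b+(e+1)) \<le> of_int (e + 1)"
      using niceD[OF nice, of "e+1"] e0 eL by simp
    then have "32 * holes B b (b+(e+1)) \<le> of_int (e + 1)" using holes_nonneg[of A a "a+(e+1)"]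
      by linarith
    then have "32 * holes B b (b+e+1) \<le> of_int (e + 1)" by (simp add: add.assoc)
    moreover have "real (card (B \<inter> {b..<b+e+1})) + holes B b (b+e+1) = of_int (e + 1)"
      using holes_plus_card[of b "b+e+1" B] e0 by simp
    moreover have "real_of_int (e + 1) = 2 * of_int f - 1" using e by simp
    moreover have "(1::real) \<le> of_int f" using f1 by simp
    ultimately have "of_int f - 1 < real (card (B \<inter> {b..<b+e+1}))" by linarith
    then have "f - 1 < int (card (B \<inter> {b..<b+e+1}))" by linarith
    then show ?thesis by linarith
  qed
  have fail_f: "real (card (A \<inter> {0..<a - int n + e + 1})) < of_int f"
  proof (rule ccontr)
    assume c: "\<not> ?thesis"
    have "collects A B k1 k2 a b r" unfolding collects_def
    proof (rule two_sided_collect[where p = "int n"])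
      show "f = \<lceil>eps * of_int r\<rceil>" by (rule f)
      show "real (card (A \<inter> {0..<a})) + 8 * eps * of_int r \<le> of_int (int n) + holes A a (a + r - int n)"
        using Pn unfolding P_def TA_def by simp
      show "real (card (A \<inter> {0..<a})) + real (card (B \<inter> {0..<b})) \<le> of_int r"
      using T[unfolded distrib_left] of_nat_0_le_iff[of "card (A \<inter> {0..<a})", where ?'a = real]
        of_nat_0_le_iff[of "card (B \<inter> {0..<b})", where ?'a = real] by linarith
    qed (use e ab r nr rk cB c in auto)
    then show False using fail by simp
  qed
  have q2: "of_int (e + 1) = 2 * of_int f - (1::real)" using e by simp
  have niceA: "32 * holes A a (a+s) \<le> of_int s" if "0 \<le> s" "s \<le> 4 * L" for s
    using niceD[OF nice that] holes_nonneg[of B b "b+s"] by linarith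
  have cint: "real (card (A \<inter> {0..<a - int n + e + 1})) \<le> of_int f - 1" using fail_f by (rule real_less_imp_le_minus_one)
  have n1: "1 \<le> n"
  proof (rule ccontr)
    assume "\<not> 1 \<le> n"
    then have n0: "int n = 0" by simp
    have "card (A \<inter> {0..<a+(e+1)}) = card (A \<inter> {0..<a}) + card (A \<inter> {a..<a+(e+1)})"
      using e0 ab by (intro card_Int_split) auto
    moreover have "real (card (A \<inter> {a..<a+(e+1)})) + holes A a (a+(e+1)) = of_int (e + 1)"
      using holes_plus_card[of a "a+(e+1)" A] e0 by simp
    moreover have "32 * holes A a (a+(e+1)) \<le> of_int (e + 1)" using niceA[of "e+1"] e0 eL by simp
    ultimately have "real (card (A \<inter> {0..<a+(e+1)})) > of_int f - 1" using q2 f1 by linarith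
    then show False using cint n0 by (simp add: add.assoc)
  qed
  \<comment> \<open>Minimality of \<open>n\<close> bounds the gain from above, up to the step size
    1; the integrality in \<open>cint\<close> makes up for this 1.\<close>
  have "\<not> P (n - 1)" using n1 not_less_Least[of "n - 1" P] by (auto simp: n_def)
  moreover have "holes A a (a + r - int n) \<le> holes A a (a + r - int (n - 1))"
    by (intro holes_mono) auto
  ultimately have up: "real n + holes A a (a + r - int n) < TA + 8 * eps * of_int r + 1"
    using n1 unfolding P_def by (simp add: of_nat_diff)
  \<comment> \<open>Compare two bounds for \<open>|A \<inter> [0, a)|\<close>: the lower one from
    minimality, and the upper one from the few elements in front of \<open>a - n + e + 1\<close>. If
    that point lies beyond \<open>a\<close>, niceness accounts for the part behind
    \<open>a\<close>.\<close>
  have full: "holes A a (a + r - int n) \<le> 8 * eps * of_int r"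
  proof (cases "int n \<ge> e + 1")
    case True
    have "TA \<le> real (card (A \<inter> {0..<a - int n + e + 1})) + of_int (a - (a - int n + e + 1))"
      unfolding TA_def using True by (intro card_Int_le_add_length) auto
    then have "TA \<le> (of_int f - 1) + (real n - of_int (e + 1))" using cint by simp
    then show ?thesis using up q2 f1 by linarith
  next
    case False
    define s where "s = e + 1 - int n"
    have s: "0 \<le> s" "s \<le> 4 * L" using False eL by (auto simp: s_def)
    have as: "a - int n + e + 1 = a + s" by (simp add: s_def)
    have "card (A \<inter> {0..<a+s}) = card (A \<inter> {0..<a}) + card (A \<inter> {a..<a+s})"
      using s ab by (intro card_Int_split) auto
    moreover have "real (card (A \<inter> {a..<a+s})) + holes A a (a+s) = of_int s"
      using holes_plus_card[of a "a+s" A] s by simp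
    moreover have "32 * holes A a (a+s) \<le> of_int s" using niceA[of s] s by simp
    moreover have "of_int s = of_int (e + 1) - real n" by (simp add: s_def)
    ultimately show ?thesis using cint[unfolded as] up q2 f1 TA unfolding TA_def by linarith
  qed
  show ?thesis using n1 up fail_f full unfolding TA_def by (intro exI[of _ "int n"]) auto
qed

text \<open>By \<open>not_collects_imp_full\<close>, \<open>A\<close> is nearly full from a point \<open>a0\<close> close to its beginning up to \<open>a\<close>, and both
  sets are nearly full behind \<open>a\<close> and \<open>b\<close> at all scales beyond \<open>4 t\<close>. The rising sun argument for
  the smaller scales then yields a nice pair \<open>(a0 + i, b + i)\<close> with \<open>i \<le> t / 10\<close>.\<close>

lemma nice_descent:
  fixes A B :: "int set" and L a b t :: int
  assumes nice: "nice A B L a b" and ab: "0 \<le> a" "0 \<le> b" "2 * a \<le> L" "2 * b \<le> L"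
    and t: "t = int (card (A \<inter> {0..<a})) + int (card (B \<inter> {0..<b}))" and t1: "1 \<le> t" and tL: "128 * t \<le> L"
    and hol: "holes A 0 (5 * L) + holes B 0 (5 * L) \<le> of_int L / 10000"
    and Lk: "of_int L \<le> real k1 * real k2"
    and AB: "card (B \<inter> {0..<b}) \<le> card (A \<inter> {0..<a})"
    and fail: "\<And>r. 8 * t \<le> r \<Longrightarrow> 2 * r \<le> L \<Longrightarrow> \<not> collects A B k1 k2 a b r"
  shows "\<exists>a' b'. nice A B L a' b' \<and> 0 \<le> a' \<and> 0 \<le> b' \<and> 2 * a' \<le> L \<and> 2 * b' \<le> L \<and>
           int (card (A \<inter> {0..<a'})) + int (card (B \<inter> {0..<b'})) < t"
proof -
  define TA where "TA = real (card (A \<inter> {0..<a}))"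
  define TB where "TB = real (card (B \<inter> {0..<b}))"
  have tT: "of_int t = TA + TB" by (simp add: t TA_def TB_def)
  have TAB: "0 \<le> TB" "TB \<le> TA" using AB by (auto simp: TA_def TB_def)
  have t1': "(1::real) \<le> of_int t" using t1 by simp
  \<comment> \<open>Use \<open>r = 2 s\<close>: the resulting \<open>p\<close> is at most
    \<open>s\<close>, so \<open>[a, a + s)\<close> lies in the stretch known to be nearly
    full.\<close>
  have fullA: "holes A a (a+s) \<le> 16 * eps * of_int s"
    and fullB: "holes B b (b+s) \<le> 16 * eps * of_int s" if s: "4 * t \<le> s" "4 * s \<le> L" for s
  proof -
    have rk: "of_int (2 * s) \<le> real k1 * real k2" using Lk s t1 by simp
    have st: "4 * real_of_int t \<le> of_int s" using s by linarith
    have T8: "8 * (TA + TB) \<le> of_int (2 * s)" using st tT by simp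
    have T8': "8 * (TB + TA) \<le> of_int (2 * s)" using T8 by (simp add: add.commute)
    have nc: "\<not> collects A B k1 k2 a b (2 * s)" using fail[of "2 * s"] s t1 by auto
    have nc': "\<not> collects B A k2 k1 b a (2 * s)" using nc collects_commute by blast
    from not_collects_imp_full[OF nice ab(1,2) T8[unfolded TA_def TB_def] _ _ rk refl refl nc] s t1
    obtain p where p: "of_int p + holes A a (a+2*s-p) < TA + 8 * eps * of_int (2*s) + 1"
      "holes A a (a+2*s-p) \<le> 8 * eps * of_int (2*s)" unfolding TA_def by auto
    have "real_of_int p \<le> of_int s"
      using p(1) holes_nonneg[of A a "a+2*s-p"] st t1' tT TAB
      unfolding of_int_mult of_int_numeral by linarith
    then have "holes A a (a+s) \<le> holes A a (a+2*s-p)" by (intro holes_mono) auto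
    then show "holes A a (a+s) \<le> 16 * eps * of_int s" using p(2) by simp
    have rk': "of_int (2 * s) \<le> real k2 * real k1" using rk by (simp add: mult.commute)
    have nice': "nice B A L b a" using nice nice_commute by blast
    from not_collects_imp_full[OF nice' ab(2,1) T8'[unfolded TA_def TB_def] _ _ rk' refl refl nc'] s t1
    obtain p where p: "of_int p + holes B b (b+2*s-p) < TB + 8 * eps * of_int (2*s) + 1"
      "holes B b (b+2*s-p) \<le> 8 * eps * of_int (2*s)" unfolding TB_def by auto
    have "real_of_int p \<le> of_int s"
      using p(1) holes_nonneg[of B b "b+2*s-p"] st t1' tT TAB
      unfolding of_int_mult of_int_numeral by linarith
    then have "holes B b (b+s) \<le> holes B b (b+2*s-p)" by (intro holes_mono) auto
    then show "holes B b (b+s) \<le> 16 * eps * of_int s" using p(2) by simp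
  qed
  \<comment> \<open>Use \<open>r = 16 t\<close>. Fewer than \<open>f\<close> elements of
    \<open>A\<close> lie in front of \<open>q = a - p + e + 1\<close>, and \<open>p\<close> hardly
    exceeds the number of elements of \<open>A\<close> in front of \<open>a\<close>, so few holes
    fit between \<open>q\<close> and \<open>a\<close>.\<close>
  obtain a0 where a0: "0 \<le> a0" "a0 \<le> a" "real (card (A \<inter> {0..<a0})) \<le> 16 * eps * of_int t"
    "holes A a0 a \<le> 128 * eps * of_int t"
  proof -
    define f where "f = \<lceil>eps * of_int (16 * t)\<rceil>"
    define e where "e = 2 * (f - 1)"
    have f1: "1 \<le> f" using t1 unfolding f_def by linarith
    have fr: "of_int f < eps * of_int (16 * t) + 1" unfolding f_def by linarith
    have T8: "8 * (TA + TB) \<le> of_int (16 * t)" using tT t1' by simp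
    have rk: "of_int (16 * t) \<le> real k1 * real k2" using Lk tL t1 by linarith
    have nc: "\<not> collects A B k1 k2 a b (16 * t)" using fail[of "16 * t"] tL t1 by auto
    from not_collects_imp_full[OF nice ab(1,2) T8[unfolded TA_def TB_def] _ _ rk f_def e_def nc] t1 tL
    obtain p where p: "of_int p + holes A a (a+16*t-p) < TA + 8 * eps * of_int (16*t) + 1"
      "real (card (A \<inter> {0..<a-p+e+1})) < of_int f" unfolding TA_def by auto
    define q where "q = a - p + e + 1"
    have cq: "real (card (A \<inter> {0..<q})) \<le> of_int f - 1" using p(2) unfolding q_def by (rule real_less_imp_le_minus_one)
    have qa: "q < a"
    proof (rule ccontr)
      assume "\<not> q < a"
      then have "card (A \<inter> {0..<a}) \<le> card (A \<inter> {0..<q})" by (intro card_mono) auto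
      then have "TA \<le> of_int f - 1" using cq unfolding TA_def by linarith
      then show False using fr tT TAB t1' by simp
    qed
    define a0 where "a0 = max 0 q"
    have i0: "{0..<a0} = {0..<q}" by (auto simp: a0_def)
    have b1: "0 \<le> a0" "a0 \<le> a" using qa ab by (auto simp: a0_def)
    have "card (A \<inter> {0..<a}) = card (A \<inter> {0..<a0}) + card (A \<inter> {a0..<a})"
      using b1 by (intro card_Int_split) auto
    moreover have "real (card (A \<inter> {a0..<a})) + holes A a0 a = of_int (a - a0)"
      using b1 by (intro holes_plus_card) auto
    moreover have "of_int (a - a0) \<le> real_of_int (a - q)" by (simp add: a0_def)
    moreover have "real_of_int (a - q) = of_int p - of_int e - 1" by (simp add: q_def)
    moreover have "real_of_int e = 2 * of_int f - 2" by (simp add: e_def)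
    ultimately have "holes A a0 a \<le> 128 * eps * of_int t"
      using p(1) cq f1 holes_nonneg[of A a "a+16*t-p"] unfolding TA_def i0 of_int_mult by linarith
    moreover have "real (card (A \<inter> {0..<a0})) \<le> 16 * eps * of_int t" using cq fr unfolding i0 by simp
    ultimately show thesis using that b1 by blast
  qed
  define F where "F = (\<lambda>j. holes A a0 (a0+j) + holes B b (b+j))"
  have F0: "0 \<le> F j" for j by (simp add: F_def)
  have F: "F j \<le> 128 * eps * of_int t + 32 * eps * of_int m" if "0 \<le> j" "4 * t \<le> m" "j \<le> m" "4 * m \<le> L" for j m
  proof -
    have "holes A a0 (a0+j) \<le> holes A a0 (a+m)" using that a0 by (intro holes_mono) auto
    also have "\<dots> = holes A a0 a + holes A a (a+m)" using that a0 t1 by (intro holes_split) auto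
    finally have "holes A a0 (a0+j) \<le> 128 * eps * of_int t + 16 * eps * of_int m"
      using a0 fullA[of m] that by simp
    moreover have "holes B b (b+j) \<le> holes B b (b+m)" using that by (intro holes_mono) auto
    ultimately show ?thesis using fullB[of m] that unfolding F_def by simp
  qed
  have Fdiff: "F (i + s) - F i = holes A (a0+i) (a0+i+s) + holes B (b+i) (b+i+s)" if "0 \<le> i" "0 \<le> s" for i s
    using that holes_split[of a0 "a0+i" "a0+i+s" A] holes_split[of b "b+i" "b+i+s" B]
    by (simp add: F_def add.assoc)
  \<comment> \<open>Shifts up to \<open>t / 10\<close> leave more candidates than the rising sun
    argument excludes, which is about \<open>t / 100\<close>.\<close>
  define n where "n = t div 10 + 1"
  have n: "10 * n - 10 \<le> t" "t < 10 * n" "1 \<le> n" using t1 unfolding n_def by auto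
  define Bad where "Bad = {i \<in> {0..<n}. \<exists>s\<in>{1..4*t}. 32 * (F (i + s) - F i) > of_int s}"
  have "real (card Bad) \<le> 32 * (F (n + 4*t) - F 0)"
    unfolding Bad_def
  proof (rule rising_sun)
    fix x y :: int assume "0 \<le> x" "x \<le> y"
    then show "F x \<le> F y" unfolding F_def by (intro add_mono holes_mono) auto
  qed (use n t1 in auto)
  also have "\<dots> \<le> 32 * (128 * eps * of_int t + 32 * eps * of_int (6 * t))"
    using F[of "n + 4*t" "6*t"] F0[of 0] n t1 tL by simp
  also have "\<dots> < of_int n"
  proof -
    have "real_of_int t < 10 * of_int n" using n by linarith
    then show ?thesis using n by simp
  qed
  finally have "card Bad < nat n" using n by linarith
  then have "Bad \<noteq> {0..<n}" by auto
  moreover have "Bad \<subseteq> {0..<n}" by (auto simp: Bad_def)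
  ultimately obtain i where i: "0 \<le> i" "i < n" "i \<notin> Bad" by fastforce
  have it: "10 * i \<le> t" using i n by linarith
  have tot: "holes A (a0+i) (a0+i+s) + holes B (b+i) (b+i+s) \<le> of_int L / 10000" if "s \<le> 4 * L" for s
  proof -
    have "holes A (a0+i) (a0+i+s) \<le> holes A 0 (5 * L)"
      using that a0 ab i it tL by (intro holes_mono) auto
    moreover have "holes B (b+i) (b+i+s) \<le> holes B 0 (5 * L)"
      using that ab i it tL by (intro holes_mono) auto
    ultimately show ?thesis using hol by linarith
  qed
  have nice': "nice A B L (a0+i) (b+i)" unfolding nice_def
  proof (intro allI impI)
    fix s assume s: "1 \<le> s \<and> s \<le> 4 * L"
    \<comment> \<open>Small scales are settled by the choice of \<open>i\<close>, middle ones by the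
      near fullness behind \<open>a\<close> and \<open>b\<close>, large ones by the total number of
      holes.\<close>
    consider "s \<le> 4 * t" | "s > 4 * t" "4 * (i + s) \<le> L" | "4 * (i + s) > L" by linarith
    then show "32 * (holes A (a0+i) (a0+i+s) + holes B (b+i) (b+i+s)) \<le> of_int s"
    proof cases
      case 1
      then have "32 * (F (i + s) - F i) \<le> of_int s" using i s unfolding Bad_def by force
      then show ?thesis using Fdiff[of i s] i s by simp
    next
      case 2
      have "F (i + s) \<le> 128 * eps * of_int t + 32 * eps * of_int (i + s)"
        using F[of "i+s" "i+s"] 2 i s by simp
      moreover have "real_of_int (i + s) \<le> 2 * of_int s" "4 * real_of_int t < of_int s" using 2 it t1 by linarith+
      moreover have "(0::real) < of_int s" using s by simp
      ultimately have "32 * F (i + s) \<le> of_int s" unfolding of_int_add distrib_left by linarith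
      then have "32 * (F (i + s) - F i) \<le> of_int s"
        using F0[of i] unfolding right_diff_distrib by linarith
      then show ?thesis using Fdiff[of i s] i s by simp
    next
      case 3
      have "L < 8 * s" using 3 it tL t1 unfolding distrib_left by linarith
      then have "real_of_int L < 8 * of_int s" by linarith
      moreover have "(0::real) < of_int s" using s by simp
      ultimately show ?thesis using tot[of s] s unfolding distrib_left by linarith
    qed
  qed
  have cA: "real (card (A \<inter> {0..<a0+i})) \<le> real (card (A \<inter> {0..<a0})) + of_int i"
    using card_Int_le_add_length[of a0 "a0+i" A 0] i by simp
  have cB: "real (card (B \<inter> {0..<b+i})) \<le> TB + of_int i"
    using card_Int_le_add_length[of b "b+i" B 0] i by (simp add: TB_def)
  have it': "10 * real_of_int i \<le> of_int t" using it by linarith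
  \<comment> \<open>The larger part, at least \<open>t / 2\<close>, is replaced by
    \<open>16 eps t\<close>, while the shifts add at most \<open>t / 5\<close>.\<close>
  have less: "real (card (A \<inter> {0..<a0+i})) + real (card (B \<inter> {0..<b+i})) < of_int t"
    using cA cB a0(3) it' tT TAB t1' by linarith
  have tL': "128 * real_of_int t \<le> of_int L" using tL by linarith
  \<comment> \<open>The new points stay below \<open>L / 2\<close> however often the descent is
    repeated: in front of them there are fewer than \<open>t \<le> L / 128\<close> elements and at
    most \<open>L / 10000\<close> holes of the set concerned.\<close>
  have hA: "holes A 0 (a0+i) \<le> of_int L / 10000" and hB: "holes B 0 (b+i) \<le> of_int L / 10000"
  proof -
    have "holes A 0 (a0+i) \<le> holes A 0 (5*L)" "holes B 0 (b+i) \<le> holes B 0 (5*L)"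
      using a0 ab i it tL t1 by (auto intro!: holes_mono)
    then show "holes A 0 (a0+i) \<le> of_int L / 10000" "holes B 0 (b+i) \<le> of_int L / 10000"
      using hol holes_nonneg[of A 0 "5*L"] holes_nonneg[of B 0 "5*L"] by linarith+
  qed
  have "2 * real_of_int (a0+i) \<le> of_int L"
    using holes_plus_card[of 0 "a0+i" A] a0 i hA less tL' t1' by simp
  moreover have "2 * real_of_int (b+i) \<le> of_int L"
    using holes_plus_card[of 0 "b+i" B] ab i hB less tL' t1' by simp
  ultimately have "2 * (a0+i) \<le> L" "2 * (b+i) \<le> L" by linarith+
  moreover have "int (card (A \<inter> {0..<a0+i})) + int (card (B \<inter> {0..<b+i})) < t" using less by linarith
  ultimately show ?thesis using nice' a0 ab i
    by (intro exI[of _ "a0+i"] exI[of _ "b+i"]) auto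
qed

text \<open>Descent on the number of elements in front of the pair: as long as nothing can be
  collected, \<open>nice_descent\<close>, applied to \<open>A\<close> and \<open>B\<close> or to the
  swapped pair, makes it smaller.\<close>

lemma nice_imp_collects:
  fixes A B :: "int set" and L a b :: int
  assumes nice: "nice A B L a b" and ab: "0 \<le> a" "0 \<le> b" "2 * a \<le> L" "2 * b \<le> L"
    and tL: "128 * (int (card (A \<inter> {0..<a})) + int (card (B \<inter> {0..<b}))) \<le> L"
    and hol: "holes A 0 (5 * L) + holes B 0 (5 * L) \<le> of_int L / 10000"
    and Lk: "of_int L \<le> real k1 * real k2"
  shows "\<exists>a b r. nice A B L a b \<and> 0 \<le> a \<and> 0 \<le> b \<and> 2 * a \<le> L \<and> 2 * b \<le> L \<and> 0 \<le> r \<and> 2 * r \<le> L \<and>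
           collects A B k1 k2 a b r"
  using nice ab tL
proof (induction "card (A \<inter> {0..<a}) + card (B \<inter> {0..<b})" arbitrary: a b rule: less_induct)
  case less
  define t where "t = int (card (A \<inter> {0..<a})) + int (card (B \<inter> {0..<b}))"
  show ?case
  proof (cases "t = 0")
    case True
    \<comment> \<open>Nothing lies in front of the pair, so empty sets and \<open>r = 0\<close>
      suffice.\<close>
    then have "collects A B k1 k2 a b 0" unfolding collects_def t_def
      by (intro exI[of _ "{}"] conjI) auto
    then show ?thesis using less.prems by (intro exI[of _ a] exI[of _ b] exI[of _ 0]) auto
  next
    case False
    then have t1: "1 \<le> t" unfolding t_def by linarith
    show ?thesis
    proof (cases "\<exists>r. 8 * t \<le> r \<and> 2 * r \<le> L \<and> collects A B k1 k2 a b r")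
      case True
      then obtain r where "8 * t \<le> r" "2 * r \<le> L" "collects A B k1 k2 a b r" by blast
      then show ?thesis using less.prems t1 by (intro exI[of _ a] exI[of _ b] exI[of _ r]) auto
    next
      case False
      then have fail: "\<And>r. 8 * t \<le> r \<Longrightarrow> 2 * r \<le> L \<Longrightarrow> \<not> collects A B k1 k2 a b r" by blast
      have "\<exists>a' b'. nice A B L a' b' \<and> 0 \<le> a' \<and> 0 \<le> b' \<and> 2 * a' \<le> L \<and> 2 * b' \<le> L \<and>
           int (card (A \<inter> {0..<a'})) + int (card (B \<inter> {0..<b'})) < t"
      proof (cases "card (B \<inter> {0..<b}) \<le> card (A \<inter> {0..<a})")
        case True
        show ?thesis
          by (rule nice_descent[OF less.prems(1-5) t_def t1 _ hol Lk True fail]) (use less.prems t_def in auto)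
      next
        case False
        have "\<exists>b' a'. nice B A L b' a' \<and> 0 \<le> b' \<and> 0 \<le> a' \<and> 2 * b' \<le> L \<and> 2 * a' \<le> L \<and>
           int (card (B \<inter> {0..<b'})) + int (card (A \<inter> {0..<a'})) < t"
        proof (rule nice_descent[where a = b and b = a and ?k1.0 = k2 and ?k2.0 = k1])
          show "nice B A L b a" using less.prems(1) nice_commute by blast
          show "\<not> collects B A k2 k1 b a r" if "8 * t \<le> r" "2 * r \<le> L" for r
            using fail[OF that] collects_commute by blast
        qed (use less.prems t_def t1 hol Lk False in \<open>auto simp: mult.commute\<close>)
        then obtain b' a' where "nice B A L b' a'" "0 \<le> b'" "0 \<le> a'" "2 * b' \<le> L" "2 * a' \<le> L"
           "int (card (B \<inter> {0..<b'})) + int (card (A \<inter> {0..<a'})) < t" by blast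
        then show ?thesis using nice_commute[of A B L a' b']
          by (intro exI[of _ a'] exI[of _ b']) auto
      qed
      then obtain a' b' where 1: "nice A B L a' b'" "0 \<le> a'" "0 \<le> b'" "2 * a' \<le> L" "2 * b' \<le> L"
           "int (card (A \<inter> {0..<a'})) + int (card (B \<inter> {0..<b'})) < t" by blast
      show ?thesis
        by (rule less.hyps[OF _ 1(1-5)]) (use 1(6) less.prems(6) t_def in auto)
    qed
  qed
qed

lemma exists_nice_collects:
  fixes A B :: "int set" and L :: int
  assumes L: "2 \<le> L" and hol: "holes A 0 (5 * L) + holes B 0 (5 * L) \<le> of_int L / 10000"
    and Lk: "of_int L \<le> real k1 * real k2"
  shows "\<exists>a b r. nice A B L a b \<and> 0 \<le> a \<and> 0 \<le> b \<and> 2 * a \<le> L \<and> 2 * b \<le> L \<and> 0 \<le> r \<and> 2 * r \<le> L \<and>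
           collects A B k1 k2 a b r"
proof -
  define F where "F = (\<lambda>j. holes A 0 j + holes B 0 j)"
  \<comment> \<open>The rising sun argument excludes at most \<open>32 L / 10000 < n\<close> points.
    A point \<open>i \<le> L / 256\<close> has at most \<open>2 i \<le> L / 128\<close> elements in
    front of it, as the descent requires.\<close>
  define n where "n = L div 256 + 1"
  have n: "256 * (n - 1) \<le> L" "L < 256 * n" "1 \<le> n" using L unfolding n_def by auto
  define Bad where "Bad = {i \<in> {0..<n}. \<exists>s\<in>{1..4*L}. 32 * (F (i + s) - F i) > of_int s}"
  have "real (card Bad) \<le> 32 * (F (n + 4*L) - F 0)"
    unfolding Bad_def
  proof (rule rising_sun)
    fix x y :: int assume "0 \<le> x" "x \<le> y"
    then show "F x \<le> F y" unfolding F_def by (intro add_mono holes_mono) auto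
  qed (use n L in auto)
  also have "\<dots> \<le> 32 * (of_int L / 10000)"
  proof -
    have "F (n + 4*L) \<le> F (5*L)" unfolding F_def using n L by (intro add_mono holes_mono) auto
    then show ?thesis using hol by (simp add: F_def)
  qed
  also have "\<dots> < of_int n"
  proof -
    have "real_of_int L < 256 * of_int n" using n by linarith
    then show ?thesis using n by simp
  qed
  finally have "card Bad < nat n" using n by linarith
  then have "Bad \<noteq> {0..<n}" by auto
  moreover have "Bad \<subseteq> {0..<n}" by (auto simp: Bad_def)
  ultimately obtain i where i: "0 \<le> i" "i < n" "i \<notin> Bad" by fastforce
  have Fdiff: "F (i + s) - F i = holes A i (i+s) + holes B i (i+s)" if "0 \<le> s" for s
    using that i holes_split[of 0 i "i+s" A] holes_split[of 0 i "i+s" B] by (simp add: F_def)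
  have nice: "nice A B L i i" unfolding nice_def
  proof (intro allI impI)
    fix s assume s: "1 \<le> s \<and> s \<le> 4 * L"
    then have "32 * (F (i + s) - F i) \<le> of_int s" using i unfolding Bad_def by force
    then show "32 * (holes A i (i+s) + holes B i (i+s)) \<le> of_int s" using Fdiff[of s] s by simp
  qed
  have c: "int (card (C \<inter> {0..<i})) \<le> i" for C
  proof -
    have "card (C \<inter> {0..<i}) \<le> card {0..<i}" by (rule card_mono) auto
    then show ?thesis using i by simp
  qed
  show ?thesis
    by (rule nice_imp_collects[OF nice _ _ _ _ _ hol Lk]) (use i n c[of A] c[of B] L in auto)
qed

section \<open>Covering one end of the range\<close>

lemma holes_antimono: "S \<subseteq> S' \<Longrightarrow> holes S' u v \<le> holes S u v"
  unfolding holes_def by (intro of_nat_mono card_mono) auto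

text \<open>Collected sums balance the holes in front of \<open>a + b + r\<close>, and the forward
  cover handles the rest at a small cost. Charging holes beyond \<open>L\<close> with weight only
  \<open>1/10\<close> leaves room for the charges of the middle and of the other end.\<close>

lemma end_cover:
  fixes X Y :: "int set" and R L :: int and J :: nat
  assumes R: "1 \<le> R" and J: "1 \<le> J" and L: "L = R * 4 ^ J"
    and hol: "holes X 0 (5 * L) + holes Y 0 (5 * L) \<le> of_int L / 10000"
  shows "\<exists>X'\<subseteq>X. \<exists>Y'\<subseteq>Y. finite X' \<and> finite Y' \<and>
     real (card X') \<le> (2 / eps\<^sup>2 + 400) * 2 ^ J \<and>
     real (card Y') \<le> (2 / eps\<^sup>2 + 400) * (of_int R * 2 ^ J) \<and>
     holes (X' + Y') 0 (4 * L) \<le> holes X 0 L + holes Y 0 L + (holes X L (5 * L) + holes Y L (5 * L)) / 10"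
proof -
  define k1 :: nat where "k1 = 2 ^ J"
  define k2 :: nat where "k2 = nat R * 2 ^ J"
  have k: "real k1 = 2 ^ J" "real k2 = of_int R * 2 ^ J" using R by (auto simp: k1_def k2_def)
  have J1: "1 \<le> (2::real) ^ J" by simp
  have RJ: "1 \<le> real_of_int R" "of_int R \<le> real_of_int R * 2 ^ J" using R J1 by auto
  have "(4::int) ^ 1 \<le> 4 ^ J" using J by (intro power_increasing) auto
  then have RL: "4 * R \<le> L" using R L mult_left_mono[of 4 "4^J" R] by simp
  have "(4::real) ^ J = 2 ^ J * 2 ^ J" by (simp flip: power_mult_distrib)
  then have Lk: "of_int L \<le> real k1 * real k2" by (simp add: k L)
  from exists_nice_collects[OF _ hol Lk] RL R
  obtain a b r where nice: "nice X Y L a b" and ab: "0 \<le> a" "0 \<le> b" "2 * a \<le> L" "2 * b \<le> L"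
    and r: "0 \<le> r" "2 * r \<le> L" and col: "collects X Y k1 k2 a b r" by auto
  from col obtain X1 Y1 where 1: "X1 \<subseteq> X" "Y1 \<subseteq> Y" "finite X1" "finite Y1"
     "real (card X1) \<le> (2 / eps\<^sup>2 + 2) * real k1" "real (card Y1) \<le> (2 / eps\<^sup>2 + 2) * real k2"
     "real (card (X \<inter> {0..<a})) + real (card (Y \<inter> {0..<b})) + of_int r
       - (holes X a (a+r) + holes Y b (b+r)) + eps * of_int r \<le> real (card ((X1 + Y1) \<inter> {0..<a+b+r}))"
    unfolding collects_def by blast
  \<comment> \<open>The number 21 makes \<open>2 * 24 / 2^21\<close> smaller than
    \<open>32 * eps\<close>.\<close>
  from forward_cover[OF R _ L nice, of 21]
  obtain X2 Y2 where 2: "X2 \<subseteq> X" "Y2 \<subseteq> Y" "finite X2" "finite Y2"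
     "real (card X2) \<le> 21 * 2 ^ J + 1"
     "real (card Y2) \<le> 14 * 21 * of_int R * 2 ^ J + of_int R"
     "\<forall>y\<in>Y \<inter> {b..<b+R}. a + y \<in> X2 + Y2"
     "holes (X2 + Y2) (a+b+R) (a+b+4*L) \<le>
       24 / 2 ^ 21 * ((holes X (a+R) (a+4*L) + holes Y (b+R) (b+4*L)) + (holes X (a+R) (a+L) + holes Y (b+R) (b+L)))"
    by (auto simp: holes_def)
  define S where "S = (X1 \<union> X2) + (Y1 \<union> Y2)"
  have sub: "X1 + Y1 \<subseteq> S" "X2 + Y2 \<subseteq> S" unfolding S_def by (intro set_plus_mono2; simp)+
  define N where "N = a + b"
  define r' where "r' = max r R"
  have r': "0 \<le> r'" "r \<le> r'" "R \<le> r'" "2 * r' \<le> L" using r R RL by (auto simp: r'_def)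
  have h1: "holes S 0 (N+r) \<le> holes X 0 (a+r) + holes Y 0 (b+r) - eps * of_int r"
  proof -
    have "holes S 0 (N+r) \<le> holes (X1+Y1) 0 (N+r)" using sub by (intro holes_antimono)
    moreover have "real (card ((X1 + Y1) \<inter> {0..<N+r})) + holes (X1+Y1) 0 (N+r) = of_int (N + r - 0)"
      using ab r by (intro holes_plus_card) (auto simp: N_def)
    moreover have "real (card (X \<inter> {0..<a})) + holes X 0 a = of_int (a - 0)"
      "real (card (Y \<inter> {0..<b})) + holes Y 0 b = of_int (b - 0)" using ab by (intro holes_plus_card; auto)+
    moreover have "holes X 0 (a+r) = holes X 0 a + holes X a (a+r)"
      "holes Y 0 (b+r) = holes Y 0 b + holes Y b (b+r)" using ab r by (intro holes_split; auto)+
    ultimately show ?thesis using 1(7) unfolding N_def by simp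
  qed
  have h2: "holes S (N+R) (N+4*L) \<le> 32 * eps * holes X (a+R) (a+4*L) + 32 * eps * holes Y (b+R) (b+4*L)"
  proof -
    have q: "(24::real) / 2 ^ 21 = 24 / 2097152" by simp
    have "holes S (N+R) (N+4*L) \<le> holes (X2+Y2) (N+R) (N+4*L)" using sub by (intro holes_antimono)
    moreover have "holes X (a+R) (a+L) \<le> holes X (a+R) (a+4*L)" "holes Y (b+R) (b+L) \<le> holes Y (b+R) (b+4*L)"
      using RL R by (auto intro!: holes_mono)
    ultimately show ?thesis
      using 2(8) holes_nonneg[of X "a+R" "a+4*L"] holes_nonneg[of Y "b+R" "b+4*L"]
      unfolding N_def q distrib_left by linarith
  qed
  have main: "holes S 0 (N+4*L) \<le> holes X 0 (a+r') + holes Y 0 (b+r') +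
      32 * eps * holes X (a+r') (a+4*L) + 32 * eps * holes Y (b+r') (b+4*L)"
  proof (cases "r \<le> R")
    case True
    \<comment> \<open>The gap between the collected sums and the forward cover is filled by the
      translate \<open>a + y\<close> of \<open>Y \<inter> [b, b + R)\<close>.\<close>
    have "{N+r..<N+R} - S \<subseteq> (\<lambda>y. a + y) ` ({b+r..<b+R} - Y)"
    proof
      fix z assume z: "z \<in> {N+r..<N+R} - S"
      then have "z - a \<in> {b+r..<b+R}" by (auto simp: N_def)
      moreover have "z - a \<notin> Y"
      proof
        assume "z - a \<in> Y"
        then have "z - a \<in> Y \<inter> {b..<b+R}" using calculation r by auto
        then have "a + (z - a) \<in> S" using 2(7) sub by blast
        then show False using z by simp
      qed
      ultimately show "z \<in> (\<lambda>y. a + y) ` ({b+r..<b+R} - Y)" by (intro image_eqI[of _ _ "z - a"]) auto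
    qed
    then have "card ({N+r..<N+R} - S) \<le> card ({b+r..<b+R} - Y)" by (intro surj_card_le) auto
    then have "holes S (N+r) (N+R) \<le> holes Y (b+r) (b+R)" by (simp add: holes_def)
    moreover have "holes Y 0 (b+R) = holes Y 0 (b+r) + holes Y (b+r) (b+R)"
      using True ab r by (intro holes_split) auto
    moreover have "holes X 0 (a+r) \<le> holes X 0 (a+R)" using True by (intro holes_mono) auto
    moreover have "holes S 0 (N+4*L) = holes S 0 (N+r) + (holes S (N+r) (N+R) + holes S (N+R) (N+4*L))"
      using True ab r RL R holes_split[of 0 "N+r" "N+4*L" S] holes_split[of "N+r" "N+R" "N+4*L" S]
      by (auto simp: N_def)
    moreover have "r' = R" using True by (simp add: r'_def)
    moreover have "0 \<le> real_of_int r" using r by simp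
    ultimately show ?thesis using h1 h2 by simp
  next
    case False
    \<comment> \<open>Holes between \<open>R\<close> and \<open>r\<close> are charged once more with
      weight \<open>32 * eps\<close>. By niceness there are at most \<open>r / 32\<close> of them,
      so this costs at most the surplus \<open>eps * r\<close>.\<close>
    have "holes X (a+R) (a+4*L) = holes X (a+R) (a+r) + holes X (a+r) (a+4*L)"
      "holes Y (b+R) (b+4*L) = holes Y (b+R) (b+r) + holes Y (b+r) (b+4*L)"
      using False r RL R by (intro holes_split; auto)+
    moreover have "holes X (a+R) (a+r) \<le> holes X a (a+r)" "holes Y (b+R) (b+r) \<le> holes Y b (b+r)"
      using R by (auto intro!: holes_mono)
    moreover have "32 * holes X a (a+r) + 32 * holes Y b (b+r) \<le> of_int r"
      using niceD[OF nice, of r] r RL R by auto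
    moreover have "holes S 0 (N+4*L) = holes S 0 (N+r) + holes S (N+r) (N+4*L)"
      using ab r RL R by (intro holes_split) (auto simp: N_def)
    moreover have "holes S (N+r) (N+4*L) \<le> holes S (N+R) (N+4*L)" using False by (intro holes_mono) auto
    moreover have r'r: "r' = r" using False by (simp add: r'_def)
    ultimately show ?thesis using h1 h2 unfolding r'r by linarith
  qed
  have fin: "holes A 0 (c+r') + 32 * eps * holes A (c+r') (c+4*L) \<le> holes A 0 L + holes A L (5*L) / 10"
    if c: "0 \<le> c" "2 * c \<le> L" for A c
  proof -
    have cL: "c + r' \<le> L" using c r' by linarith
    have "holes A (c+r') (c+4*L) \<le> holes A (c+r') (5*L)" using c RL R by (intro holes_mono) auto
    moreover have "holes A (c+r') (5*L) = holes A (c+r') L + holes A L (5*L)"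
      using cL RL R by (intro holes_split) auto
    moreover have "holes A 0 L = holes A 0 (c+r') + holes A (c+r') L"
      using cL c r' by (intro holes_split) auto
    ultimately show ?thesis using holes_nonneg[of A "c+r'" L] holes_nonneg[of A L "5*L"] by linarith
  qed
  have "holes S 0 (4*L) \<le> holes S 0 (N+4*L)" using ab by (intro holes_mono) (auto simp: N_def)
  then have loss: "holes S 0 (4*L) \<le> holes X 0 L + holes Y 0 L + (holes X L (5*L) + holes Y L (5*L)) / 10"
    using main fin[of a X] fin[of b Y] ab unfolding add_divide_distrib by linarith
  have cX: "real (card (X1 \<union> X2)) \<le> (2 / eps\<^sup>2 + 400) * 2 ^ J"
  proof -
    have "real (card (X1 \<union> X2)) \<le> (2 / eps\<^sup>2 + 2) * 2 ^ J + (21 * 2 ^ J + 1)"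
      using card_Un_le[of X1 X2] 1(5)[unfolded k] 2(5) by linarith
    also have "\<dots> \<le> (2 / eps\<^sup>2 + 2) * 2 ^ J + 398 * 2 ^ J" using J1 by linarith
    also have "\<dots> = (2 / eps\<^sup>2 + 400) * 2 ^ J" by (simp add: distrib_right)
    finally show ?thesis .
  qed
  have cY: "real (card (Y1 \<union> Y2)) \<le> (2 / eps\<^sup>2 + 400) * (of_int R * 2 ^ J)"
  proof -
    have "real (card (Y1 \<union> Y2)) \<le> (2 / eps\<^sup>2 + 2) * (of_int R * 2 ^ J) + (14 * 21 * (of_int R * 2 ^ J) + of_int R)"
      using card_Un_le[of Y1 Y2] 1(6)[unfolded k] 2(6)[unfolded mult.assoc] by linarith
    also have "\<dots> \<le> (2 / eps\<^sup>2 + 2) * (of_int R * 2 ^ J) + 398 * (of_int R * 2 ^ J)" using RJ by linarith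
    also have "\<dots> = (2 / eps\<^sup>2 + 400) * (of_int R * 2 ^ J)" by (simp add: distrib_right)
    finally show ?thesis .
  qed
  show ?thesis using loss cX cY 1 2 unfolding S_def
    by (intro exI[of _ "X1 \<union> X2"] conjI exI[of _ "Y1 \<union> Y2"]) auto
qed

section \<open>Covering the whole range\<close>

text \<open>Consecutive stretches of \<open>L\<close> sums are covered one after another, always
  from windows away from both ends, so that only holes in \<open>[L, m - L)\<close> and
  \<open>[L, n - L)\<close> are charged.\<close>

lemma middle_cover:
  fixes X Y :: "int set" and R L m n :: int and J K t :: nat
  assumes R: "1 \<le> R" and L: "L = R * 4 ^ J" and m: "4 * L \<le> m" and n: "4 * L \<le> n"
    and t: "4 * L + int t * L \<le> m + n - 3 * L"
    and h: "h = holes X L (m - L) + holes Y L (n - L)"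
  shows "\<exists>X'\<subseteq>X. \<exists>Y'\<subseteq>Y. finite X' \<and> finite Y' \<and>
     real (card X') \<le> real t * (real K * 2 ^ J) \<and>
     real (card Y') \<le> real t * (3 * real K * (of_int R * 2 ^ J)) \<and>
     holes (X' + Y') (4 * L) (4 * L + int t * L) \<le> real t * ((h / of_int L) ^ K * of_int L)"
  using t
proof (induction t)
  case 0
  show ?case by (rule exI[of _ "{}"], simp, rule exI[of _ "{}"]) simp
next
  case (Suc t)
  have "(4::int) ^ J > 0" by simp
  then have L0: "0 < L" using R L by simp
  define z where "z = 4 * L + int t * L"
  have zz: "4 * L + int (Suc t) * L = z + L" by (simp add: z_def algebra_simps)
  have z: "4 * L \<le> z" "z \<le> m + n - 4 * L" using Suc.prems L0 unfolding zz by (auto simp: z_def)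
  have "4 * L + int t * L \<le> m + n - 3 * L" using z L0 unfolding z_def by simp
  from Suc.IH[OF this] obtain X1 Y1 where 1: "X1 \<subseteq> X" "Y1 \<subseteq> Y" "finite X1" "finite Y1"
     "real (card X1) \<le> real t * (real K * 2 ^ J)"
     "real (card Y1) \<le> real t * (3 * real K * (of_int R * 2 ^ J))"
     "holes (X1 + Y1) (4 * L) z \<le> real t * ((h / of_int L) ^ K * of_int L)" unfolding z_def by blast
  \<comment> \<open>As far right as possible such that the window ends by \<open>m - L\<close> and
    its partners in \<open>Y\<close> start no earlier than \<open>L\<close>; for the given range of
    \<open>z\<close> the partners then also end by \<open>n - L\<close>.\<close>
  define w where "w = min (m - 2 * L) (z - 2 * L)"
  have w: "L \<le> w" "w + L \<le> m - L" "L \<le> z - w - L" "z + L - w \<le> n - L"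
    using z m n L0 by (auto simp: w_def)
  have LN: "L = 2 ^ J * (R * 2 ^ J)"
  proof -
    have "(4::int) ^ J = 2 ^ J * 2 ^ J" by (simp flip: power_mult_distrib)
    then show ?thesis by (simp add: L)
  qed
  have "\<exists>X'\<subseteq>X. \<exists>Y'\<subseteq>Y. finite X' \<and> finite Y' \<and> real (card X') \<le> real K * of_int (2 ^ J) \<and>
           real (card Y') \<le> real K * (of_int ((z + L) - z + L) / of_int (2 ^ J) + 1) \<and>
           real (card ({z..<z+L} - (X' + Y'))) \<le> (h / of_int L) ^ K * real (card {z..<z+L})"
  proof (rule window_cover[OF _ _ LN, where w = w])
    have "holes X w (w + L) \<le> holes X L (m - L)" using w by (intro holes_mono) auto
    moreover have "holes Y (z - w - L + 1) (z + L - w) \<le> holes Y L (n - L)" using w by (intro holes_mono) auto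
    ultimately show "holes X w (w + L) + holes Y (z - w - L + 1) (z + L - w) \<le> h" using h by simp
  qed (use R L0 in auto)
  then obtain X2 Y2 where 2: "X2 \<subseteq> X" "Y2 \<subseteq> Y" "finite X2" "finite Y2" "real (card X2) \<le> real K * 2 ^ J"
    "real (card Y2) \<le> real K * (2 * of_int L / 2 ^ J + 1)"
    "holes (X2 + Y2) z (z + L) \<le> (h / of_int L) ^ K * of_int L"
    using L0 by (auto simp: holes_def)
  define S where "S = (X1 \<union> X2) + (Y1 \<union> Y2)"
  have sub: "X1 + Y1 \<subseteq> S" "X2 + Y2 \<subseteq> S" unfolding S_def by (intro set_plus_mono2; simp)+
  have "holes S (4 * L) (z + L) = holes S (4 * L) z + holes S z (z + L)"
    using z L0 by (intro holes_split) auto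
  also have "\<dots> \<le> holes (X1 + Y1) (4 * L) z + holes (X2 + Y2) z (z + L)"
    using sub by (intro add_mono holes_antimono)
  also have "\<dots> \<le> real (Suc t) * ((h / of_int L) ^ K * of_int L)"
    using 1(7) 2(7) by (simp add: distrib_right)
  finally have loss: "holes S (4 * L) (4 * L + int (Suc t) * L) \<le> real (Suc t) * ((h / of_int L) ^ K * of_int L)"
    unfolding zz .
  have cX: "real (card (X1 \<union> X2)) \<le> real (Suc t) * (real K * 2 ^ J)"
    using card_Un_le[of X1 X2] 1(5) 2(5) by (simp add: distrib_right)
  have LJ: "of_int L / 2 ^ J = (of_int R * 2 ^ J :: real)" using LN by simp
  have "1 \<le> of_int R * (2 ^ J :: real)" using R mult_mono[of 1 "of_int R :: real" 1 "2^J"] by simp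
  then have "2 * of_int L / 2 ^ J + 1 \<le> 3 * (of_int R * (2 ^ J :: real))" using LJ by simp
  then have "real K * (2 * of_int L / 2 ^ J + 1) \<le> real K * (3 * (of_int R * 2 ^ J))"
    by (intro mult_left_mono) auto
  then have "real (card Y2) \<le> 3 * real K * (of_int R * 2 ^ J)" using 2(6) by simp
  then have cY: "real (card (Y1 \<union> Y2)) \<le> real (Suc t) * (3 * real K * (of_int R * 2 ^ J))"
    using card_Un_le[of Y1 Y2] 1(6) by (simp add: distrib_right)
  show ?case using loss cX cY 1 2 unfolding S_def
    by (intro exI[of _ "X1 \<union> X2"] conjI exI[of _ "Y1 \<union> Y2"]) auto
qed

lemma sumset_reflect:
  fixes A B :: "int set"
  shows "(\<lambda>x. c - x) ` A + (\<lambda>x. d - x) ` B = (\<lambda>x. c + d - x) ` (A + B)"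
proof (intro Set.set_eqI iffI)
  fix x assume "x \<in> (\<lambda>x. c - x) ` A + (\<lambda>x. d - x) ` B"
  then obtain a b where "a \<in> A" "b \<in> B" "x = (c - a) + (d - b)" by (auto elim!: set_plus_elim)
  then show "x \<in> (\<lambda>x. c + d - x) ` (A + B)" by (intro image_eqI[of _ _ "a + b"]) auto
next
  fix x assume "x \<in> (\<lambda>x. c + d - x) ` (A + B)"
  then obtain a b where ab: "a \<in> A" "b \<in> B" "x = c + d - (a + b)" by (auto elim!: set_plus_elim)
  then have "(c - a) + (d - b) \<in> (\<lambda>x. c - x) ` A + (\<lambda>x. d - x) ` B" by (intro set_plus_intro) auto
  moreover have "(c - a) + (d - b) = x" using ab by simp
  ultimately show "x \<in> (\<lambda>x. c - x) ` A + (\<lambda>x. d - x) ` B" by simp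
qed

text \<open>\<open>end_cover\<close> for the reflected sets \<open>m - 1 - X\<close> and
  \<open>n - 1 - Y\<close>.\<close>

lemma right_end_cover:
  fixes X Y :: "int set" and R L m n :: int and J :: nat
  assumes R: "1 \<le> R" and J: "1 \<le> J" and L: "L = R * 4 ^ J"
    and hol: "holes X (m - 5 * L) m + holes Y (n - 5 * L) n \<le> of_int L / 10000"
  shows "\<exists>X'\<subseteq>X. \<exists>Y'\<subseteq>Y. finite X' \<and> finite Y' \<and>
     real (card X') \<le> (2 / eps\<^sup>2 + 400) * 2 ^ J \<and>
     real (card Y') \<le> (2 / eps\<^sup>2 + 400) * (of_int R * 2 ^ J) \<and>
     holes (X' + Y') (m + n - 1 - 4 * L) (m + n - 1) \<le> holes X (m - L) m + holes Y (n - L) n +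
       (holes X (m - 5 * L) (m - L) + holes Y (n - 5 * L) (n - L)) / 10"
proof -
  define rX where "rX = (\<lambda>x. m - 1 - x) ` X"
  define rY where "rY = (\<lambda>x. n - 1 - x) ` Y"
  have hX: "holes rX u v = holes X (m - v) (m - u)" for u v by (simp add: rX_def holes_reflect)
  have hY: "holes rY u v = holes Y (n - v) (n - u)" for u v by (simp add: rY_def holes_reflect)
  from end_cover[OF R J L, of rX rY] hol
  obtain X1 Y1 where 1: "X1 \<subseteq> rX" "Y1 \<subseteq> rY" "finite X1" "finite Y1"
     "real (card X1) \<le> (2 / eps\<^sup>2 + 400) * 2 ^ J"
     "real (card Y1) \<le> (2 / eps\<^sup>2 + 400) * (of_int R * 2 ^ J)"
     "holes (X1 + Y1) 0 (4 * L) \<le> holes X (m - L) m + holes Y (n - L) n +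
       (holes X (m - 5 * L) (m - L) + holes Y (n - 5 * L) (n - L)) / 10"
    unfolding hX hY by auto
  define X' where "X' = (\<lambda>x. m - 1 - x) ` X1"
  define Y' where "Y' = (\<lambda>x. n - 1 - x) ` Y1"
  have "X' + Y' = (\<lambda>x. (m - 1) + (n - 1) - x) ` (X1 + Y1)"
    unfolding X'_def Y'_def by (rule sumset_reflect)
  then have "holes (X' + Y') (m + n - 1 - 4 * L) (m + n - 1) = holes (X1 + Y1) 0 (4 * L)"
    by (simp only: holes_reflect) (simp add: algebra_simps)
  moreover have "X' \<subseteq> X" "Y' \<subseteq> Y" using 1 by (auto simp: X'_def Y'_def rX_def rY_def)
  moreover have "card X' \<le> card X1" "card Y' \<le> card Y1" "finite X'" "finite Y'"
    unfolding X'_def Y'_def using 1 by (auto intro: card_image_le)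
  ultimately show ?thesis using 1 by (intro exI[of _ X'] conjI exI[of _ Y']) auto
qed

text \<open>The two ends and the middle together charge each hole with total weight at most 1. Of
  the \<open>m + n - 1\<close> possible sums at most \<open>holes X 0 m + holes Y 0 n\<close> are
  lost, which is exactly \<open>|X| + |Y| \<le> |X' + Y'| + 1\<close>.\<close>

lemma nearly_full_sumset:
  fixes Q :: real
  assumes Q: "1 \<le> Q"
  shows "\<exists>C\<ge>1. \<forall>(X::int set) (Y::int set) m n R L J. X \<subseteq> {0..<m} \<longrightarrow> Y \<subseteq> {0..<n} \<longrightarrow> 1 \<le> R \<longrightarrow> 1 \<le> J \<longrightarrow>
     L = R * 4 ^ J \<longrightarrow> 100 * L \<le> m \<longrightarrow> 100 * L \<le> n \<longrightarrow> of_int m \<le> Q * of_int L \<longrightarrow> of_int n \<le> Q * of_int L \<longrightarrow>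
     holes X 0 m + holes Y 0 n \<le> of_int L / 10000 \<longrightarrow>
     (\<exists>X'\<subseteq>X. \<exists>Y'\<subseteq>Y. real (card X') \<le> C * 2 ^ J \<and> real (card Y') \<le> C * (of_int R * 2 ^ J) \<and>
        card X + card Y \<le> card (X' + Y') + 1)"
proof -
  \<comment> \<open>With at most \<open>2 Q\<close> stretches in the middle, each losing at most
    \<open>h / 2^K'\<close>, the middle costs at most \<open>h / 10\<close>.\<close>
  obtain K' where K': "20 * Q < (2::real) ^ K'" using real_arch_pow[of 2 "20 * Q"] by auto
  define K where "K = Suc K'"
  define C where "C = 2 * (2 / eps\<^sup>2 + 400) + 2 * Q * (3 * real K)"
  have C1: "1 \<le> C"
  proof -
    have "0 \<le> 2 * Q * (3 * real K)" using Q by simp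
    then show ?thesis unfolding C_def by (simp add: power2_eq_square)
  qed
  show ?thesis
  proof (intro exI[of _ C] conjI allI impI)
    fix X Y :: "int set" and m n R L :: int and J :: nat
    assume X: "X \<subseteq> {0..<m}" and Y: "Y \<subseteq> {0..<n}" and R: "1 \<le> R" and J: "1 \<le> J" and L: "L = R * 4 ^ J"
      and m: "100 * L \<le> m" and n: "100 * L \<le> n" and mQ: "of_int m \<le> Q * of_int L" and nQ: "of_int n \<le> Q * of_int L"
      and hol: "holes X 0 m + holes Y 0 n \<le> of_int L / 10000"
    have "(4::int) ^ J > 0" by simp
    then have L0: "0 < L" using R L by simp
    then have L0': "(0::real) < of_int L" by simp
    define q where "q = (m + n) div L"
    have q: "q * L \<le> m + n" "m + n < q * L + L"
    proof -
      have "m + n = q * L + (m + n) mod L" unfolding q_def by simp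
      moreover have "0 \<le> (m + n) mod L" "(m + n) mod L < L" using L0 by simp_all
      ultimately show "q * L \<le> m + n" "m + n < q * L + L" by linarith+
    qed
    have q7: "7 \<le> q"
    proof (rule ccontr)
      assume "\<not> 7 \<le> q"
      then have "q * L \<le> 6 * L" using L0 by (intro mult_right_mono) auto
      then show False using q m n L0 by linarith
    qed
    \<comment> \<open>The stretches reach from \<open>4 L\<close> to \<open>(q - 3) L\<close>, which
      is beyond \<open>m + n - 4 L\<close> and thus overlaps the right end.\<close>
    define t where "t = nat (q - 7)"
    have t: "4 * L + int t * L = q * L - 3 * L" using q7 by (simp add: t_def algebra_simps)
    have tQ: "real t \<le> 2 * Q"
    proof -
      have "real_of_int q * of_int L \<le> of_int (m + n)" using q(1) by (metis of_int_le_iff of_int_mult)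
      also have "\<dots> \<le> (2 * Q) * of_int L" using mQ nQ by simp
      finally have "of_int q \<le> 2 * Q" using L0' by simp
      then show ?thesis using q7 unfolding t_def by simp
    qed
    define h where "h = holes X L (m - L) + holes Y L (n - L)"
    have mono: "holes X u v \<le> holes X 0 m" "holes Y u' v' \<le> holes Y 0 n"
      if "0 \<le> u" "v \<le> m" "0 \<le> u'" "v' \<le> n" for u v u' v'
      using that by (auto intro!: holes_mono)
    have "holes X 0 (5 * L) + holes Y 0 (5 * L) \<le> of_int L / 10000"
      using mono[of 0 "5*L" 0 "5*L"] hol m n L0 by simp
    from end_cover[OF R J L this] obtain X1 Y1 where 1: "X1 \<subseteq> X" "Y1 \<subseteq> Y"
      "real (card X1) \<le> (2 / eps\<^sup>2 + 400) * 2 ^ J"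
      "real (card Y1) \<le> (2 / eps\<^sup>2 + 400) * (of_int R * 2 ^ J)"
      "holes (X1 + Y1) 0 (4 * L) \<le> holes X 0 L + holes Y 0 L + (holes X L (5 * L) + holes Y L (5 * L)) / 10"
      by blast
    have "holes X (m - 5 * L) m + holes Y (n - 5 * L) n \<le> of_int L / 10000"
      using mono[of "m - 5*L" m "n - 5*L" n] hol m n L0 by simp
    from right_end_cover[OF R J L this] obtain X2 Y2 where 2: "X2 \<subseteq> X" "Y2 \<subseteq> Y"
      "real (card X2) \<le> (2 / eps\<^sup>2 + 400) * 2 ^ J"
      "real (card Y2) \<le> (2 / eps\<^sup>2 + 400) * (of_int R * 2 ^ J)"
      "holes (X2 + Y2) (m + n - 1 - 4 * L) (m + n - 1) \<le> holes X (m - L) m + holes Y (n - L) n +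
       (holes X (m - 5 * L) (m - L) + holes Y (n - 5 * L) (n - L)) / 10"
      by blast
    have "4 * L + int t * L \<le> m + n - 3 * L" using t q by simp
    from middle_cover[OF R L _ _ this h_def, of K] m n L0 obtain X3 Y3 where 3: "X3 \<subseteq> X" "Y3 \<subseteq> Y"
      "real (card X3) \<le> real t * (real K * 2 ^ J)"
      "real (card Y3) \<le> real t * (3 * real K * (of_int R * 2 ^ J))"
      "holes (X3 + Y3) (4 * L) (4 * L + int t * L) \<le> real t * ((h / of_int L) ^ K * of_int L)"
      by auto
    have h0: "0 \<le> h" by (simp add: h_def)
    have hL: "h \<le> of_int L / 2" using mono[of L "m-L" L "n-L"] hol m n L0 L0' unfolding h_def by simp
    have mid: "real t * ((h / of_int L) ^ K * of_int L) \<le> h / 10"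
    proof -
      have "real t * ((h / of_int L) ^ K * of_int L) = (real t * (h / of_int L) ^ K') * h"
        using L0' by (simp add: K_def)
      also have "\<dots> \<le> (2 * Q * (1 / 2) ^ K') * h"
        using tQ h0 hL L0' Q by (intro mult_right_mono mult_mono power_mono) (auto simp: field_simps)
      also have "\<dots> \<le> (1 / 10) * h"
        using K' h0 by (intro mult_right_mono) (auto simp: power_one_over field_simps)
      finally show ?thesis by simp
    qed
    define X' where "X' = X1 \<union> X2 \<union> X3"
    define Y' where "Y' = Y1 \<union> Y2 \<union> Y3"
    define S where "S = X' + Y'"
    have sub: "X1 + Y1 \<subseteq> S" "X2 + Y2 \<subseteq> S" "X3 + Y3 \<subseteq> S"
      unfolding S_def X'_def Y'_def by (intro set_plus_mono2; blast)+
    have XY': "X' \<subseteq> X" "Y' \<subseteq> Y" using 1 2 3 by (auto simp: X'_def Y'_def)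
    define M where "M = m + n - 1 - 4 * L"
    have M: "4 * L \<le> M" "M \<le> m + n - 1" "M \<le> 4 * L + int t * L" using m n L0 t q by (auto simp: M_def)
    have "holes S 0 (m + n - 1) = holes S 0 (4 * L) + (holes S (4 * L) M + holes S M (m + n - 1))"
      using M L0 holes_split[of 0 "4*L" "m+n-1" S] holes_split[of "4*L" M "m+n-1" S] by auto
    moreover have "holes S 0 (4 * L) \<le> holes (X1 + Y1) 0 (4 * L)" "holes S M (m+n-1) \<le> holes (X2+Y2) M (m+n-1)"
      "holes S (4 * L) (4 * L + int t * L) \<le> holes (X3+Y3) (4 * L) (4 * L + int t * L)"
      using sub by (intro holes_antimono; blast)+
    moreover have "holes S (4 * L) M \<le> holes S (4 * L) (4 * L + int t * L)"
      using M by (intro holes_mono) auto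
    \<comment> \<open>Holes within \<open>L\<close> of an end have weight 1; the others get
      \<open>1/10\<close> from each end and from the middle, at most \<open>3/10\<close> in
      all.\<close>
    moreover have "holes A 0 L + holes A L (5 * L) / 10 + holes A L (k - L) / 10 + (holes A (k - L) k + holes A (k - 5 * L) (k - L) / 10)
        \<le> holes A 0 k" if "100 * L \<le> k" for A k
    proof -
      have "holes A 0 k = holes A 0 L + (holes A L (k - L) + holes A (k - L) k)"
        using that L0 holes_split[of 0 L k A] holes_split[of L "k - L" k A] by auto
      moreover have "holes A L (5 * L) \<le> holes A L (k - L)" "holes A (k - 5 * L) (k - L) \<le> holes A L (k - L)"
        using that L0 by (auto intro!: holes_mono)
      ultimately show ?thesis using holes_nonneg[of A L "k - L"] by linarith
    qed
    from this[OF m, of X] this[OF n, of Y]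
    have "holes X 0 L + holes X L (5 * L) / 10 + holes X L (m - L) / 10 + (holes X (m - L) m + holes X (m - 5 * L) (m - L) / 10)
        \<le> holes X 0 m" 
      "holes Y 0 L + holes Y L (5 * L) / 10 + holes Y L (n - L) / 10 + (holes Y (n - L) n + holes Y (n - 5 * L) (n - L) / 10)
        \<le> holes Y 0 n" by auto
    ultimately have loss: "holes S 0 (m + n - 1) \<le> holes X 0 m + holes Y 0 n"
      using 1(5) 2(5) 3(5) mid unfolding h_def M_def add_divide_distrib by linarith
    have finS: "finite S" unfolding S_def
      using X Y XY' by (intro finite_set_plus) (meson finite_subset finite_atLeastLessThan_int)+
    have "card (S \<inter> {0..<m+n-1}) \<le> card S" using finS by (intro card_mono) auto
    moreover have "real (card (S \<inter> {0..<m+n-1})) + holes S 0 (m+n-1) = of_int (m + n - 1 - 0)"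
      using m n L0 by (intro holes_plus_card) auto
    moreover have "real (card X) + holes X 0 m = of_int (m - 0)" "real (card Y) + holes Y 0 n = of_int (n - 0)"
      using holes_plus_card[of 0 m X] holes_plus_card[of 0 n Y] m n L0 X Y by (auto simp: Int_absorb2)
    ultimately have "real (card X) + real (card Y) \<le> real (card S) + 1" using loss by simp
    then have cS: "card X + card Y \<le> card (X' + Y') + 1" unfolding S_def by linarith
    have cC: "real (card (Z1 \<union> Z2 \<union> Z3)) \<le> C * x"
      if "0 \<le> x" "real (card Z1) \<le> (2 / eps\<^sup>2 + 400) * x" "real (card Z2) \<le> (2 / eps\<^sup>2 + 400) * x"
        "real (card Z3) \<le> real t * (3 * real K * x)" for Z1 Z2 Z3 :: "int set" and x
    proof -
      have "card (Z1 \<union> Z2 \<union> Z3) \<le> card Z1 + card Z2 + card Z3"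
        using card_Un_le[of "Z1 \<union> Z2" Z3] card_Un_le[of Z1 Z2] by linarith
      moreover have "real t * (3 * real K * x) \<le> 2 * Q * (3 * real K) * x"
        using tQ that(1) mult_right_mono[OF tQ, of "3 * real K * x"] by (simp add: mult.assoc)
      moreover have "C * x = (2 / eps\<^sup>2 + 400) * x + (2 / eps\<^sup>2 + 400) * x + 2 * Q * (3 * real K) * x"
        unfolding C_def by (simp only: distrib_right mult_2 mult.assoc)
      ultimately show ?thesis using that(2-4) by linarith
    qed
    have "real (card X') \<le> C * 2 ^ J" unfolding X'_def
    proof (rule cC)
      have "real K * 2 ^ J \<le> 3 * real K * 2 ^ J" by simp
      then have "real t * (real K * 2 ^ J) \<le> real t * (3 * real K * 2 ^ J)" by (intro mult_left_mono) auto
      then show "real (card X3) \<le> real t * (3 * real K * 2 ^ J)" using 3(3) by linarith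
    qed (use 1 2 in auto)
    moreover have "real (card Y') \<le> C * (of_int R * 2 ^ J)" unfolding Y'_def
      by (rule cC) (use 1 2 3 R in auto)
    ultimately show "\<exists>X'\<subseteq>X. \<exists>Y'\<subseteq>Y. real (card X') \<le> C * 2 ^ J \<and> real (card Y') \<le> C * (of_int R * 2 ^ J) \<and>
        card X + card Y \<le> card (X' + Y') + 1" using XY' cS by blast
  qed (rule C1)
qed

section \<open>Choice of the scale and sumsets of prescribed summand sizes\<close>

text \<open>Choose \<open>J\<close> such that \<open>Suc J\<close> violates one of
  \<open>D * 2^J \<le> c1\<close> and \<open>200 * 4^J \<le> n0\<close>, and \<open>R\<close> about
  \<open>n0 / (100 * 4^J)\<close>. If the second bound stops \<open>J\<close>, then
  \<open>R < 8\<close> and \<open>c1 \<le> c2\<close> suffices; if the first does,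
  \<open>2^J\<close> is of order \<open>c1\<close> and the product condition bounds
  \<open>R * 2^J\<close> by \<open>c2\<close>.\<close>

lemma balanced_scale:
  fixes D c1 c2 :: real and n0 :: int
  assumes D: "8 \<le> D" and c1: "2 * D \<le> c1" and c12: "c1 \<le> c2" and n0: "800 \<le> n0"
    and prod: "D\<^sup>2 * of_int n0 \<le> c1 * c2"
  shows "\<exists>R (J::nat) L. 1 \<le> R \<and> 1 \<le> J \<and> L = R * 4 ^ J \<and> 100 * L \<le> n0 \<and> n0 \<le> 200 * L \<and>
           D * 2 ^ J \<le> c1 \<and> D / 8 * (of_int R * 2 ^ J) \<le> c2"
proof -
  define P where "P = (\<lambda>j::nat. D * 2 ^ j \<le> c1 \<and> 200 * 4 ^ j \<le> n0)"
  have "\<exists>k<nat n0. (\<forall>i\<le>k. \<not> (\<not> P (Suc i))) \<and> \<not> P (Suc (Suc k))"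
  proof (rule ex_least_nat_less)
    have "nat n0 < 4 ^ nat n0" by (rule less_exp[THEN less_le_trans]) (simp add: power_mono)
    also have "\<dots> \<le> (4::nat) ^ Suc (nat n0)" by simp
    finally have "int (nat n0) < int (4 ^ Suc (nat n0))" by (simp only: of_nat_less_iff)
    then have "n0 < 4 ^ Suc (nat n0)" using n0 by simp
    also have "\<dots> \<le> 200 * 4 ^ Suc (nat n0)" by simp
    finally show "\<not> P (Suc (nat n0))" unfolding P_def by linarith
    show "\<not> \<not> P (Suc 0)" using c1 n0 by (simp add: P_def mult.commute)
  qed
  then obtain k where k: "P (Suc k)" "\<not> P (Suc (Suc k))" by auto
  define J where "J = Suc k"
  have J: "D * 2 ^ J \<le> c1" "200 * 4 ^ J \<le> n0" using k(1) unfolding P_def J_def by auto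
  have nJ: "c1 < 2 * (D * 2 ^ J) \<or> n0 < 800 * 4 ^ J" using k(2) unfolding P_def J_def by auto
  define R where "R = n0 div (100 * 4 ^ J)"
  define L where "L = R * 4 ^ J"
  have p4: "(0::int) < 100 * 4 ^ J" by simp
  have "n0 = (100 * 4 ^ J) * R + n0 mod (100 * 4 ^ J)" unfolding R_def by simp
  moreover have "0 \<le> n0 mod (100 * 4 ^ J)" "n0 mod (100 * 4 ^ J) < 100 * 4 ^ J" using p4 by simp_all
  moreover have "100 * L = (100 * 4 ^ J) * R" by (simp add: L_def)
  ultimately have L1: "100 * L \<le> n0" "n0 < 100 * L + 100 * 4 ^ J" by linarith+
  have R1: "1 \<le> R"
  proof -
    have "100 * 4 ^ J \<le> n0" using J(2) p4 by linarith
    then have "100 * 4 ^ J div (100 * 4 ^ J) \<le> R" unfolding R_def using p4 by (rule zdiv_mono1)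
    then show ?thesis using p4 by simp
  qed
  have "1 * 4 ^ J \<le> R * 4 ^ J" using R1 by (intro mult_right_mono) auto
  then have L2: "n0 \<le> 200 * L" using L1 unfolding L_def[symmetric] by linarith
  have "D / 8 * (of_int R * 2 ^ J) \<le> c2" using nJ
  proof
    assume "n0 < 800 * 4 ^ J"
    then have "R * 4 ^ J < 8 * 4 ^ J" using L1 unfolding L_def by linarith
    then have "R < 8" by simp
    then have "D / 8 * (of_int R * 2 ^ J) \<le> D / 8 * (8 * 2 ^ J)"
      using D by (intro mult_left_mono mult_right_mono) auto
    then show ?thesis using J c12 by simp
  next
    assume a: "c1 < 2 * (D * 2 ^ J)"
    have c0: "0 < c1" "0 < c2" using c1 D c12 by linarith+
    have "(4::real) ^ J = 2 ^ J * 2 ^ J" by (simp flip: power_mult_distrib)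
    then have LJ: "of_int L = (of_int R * 2 ^ J) * (2 ^ J :: real)" by (simp add: L_def)
    have "D\<^sup>2 * (100 * of_int L) \<le> D\<^sup>2 * of_int n0"
      using L1 by (intro mult_left_mono) (auto simp flip: of_int_le_iff[where ?'a = real])
    also have "\<dots> \<le> c1 * c2" by (rule prod)
    also have "\<dots> \<le> 2 * (D * 2 ^ J) * c2" using a c0 by (intro mult_right_mono) auto
    finally have "(D * 2 ^ J) * (D * 100 * (of_int R * 2 ^ J)) \<le> (D * 2 ^ J) * (2 * c2)"
      unfolding LJ by (simp add: power2_eq_square algebra_simps)
    then have "D * 100 * (of_int R * 2 ^ J) \<le> 2 * c2" using D by (subst (asm) mult_le_cancel_left_pos) auto
    moreover have "0 \<le> D * (of_int R * 2 ^ J)" using D R1 by simp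
    ultimately show ?thesis by simp
  qed
  then show ?thesis using R1 L1 L2 J L_def
    by (intro exI[of _ R] exI[of _ J] exI[of _ L]) (auto simp: J_def)
qed

lemma few_summands_ordered:
  fixes \<alpha> :: real
  assumes \<alpha>: "0 < \<alpha>"
  shows "\<exists>c. \<forall>(X::int set) (Y::int set) m n c1 c2. X \<subseteq> {0..<m} \<longrightarrow> Y \<subseteq> {0..<n} \<longrightarrow>
     1 \<le> c1 \<longrightarrow> c1 \<le> card X \<longrightarrow> 1 \<le> c2 \<longrightarrow> c2 \<le> card Y \<longrightarrow> c1 \<le> c2 \<longrightarrow>
     c * real (max (card X) (card Y)) \<le> real (c1 * c2) \<longrightarrow>
     \<alpha> * of_int n \<le> of_int m \<longrightarrow> \<alpha> * of_int m \<le> of_int n \<longrightarrow>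
     holes X 0 m \<le> 1 / 4000000 * of_int (min m n) \<longrightarrow> holes Y 0 n \<le> 1 / 4000000 * of_int (min m n) \<longrightarrow>
     (\<exists>X'\<subseteq>X. \<exists>Y'\<subseteq>Y. card X' = c1 \<and> card Y' = c2 \<and> card X + card Y \<le> card (X' + Y') + 1)"
proof -
  \<comment> \<open>The shorter interval has length at most \<open>200 L\<close>, the longer one at
    most \<open>max 1 (1/\<alpha>)\<close> times that.\<close>
  define Q where "Q = 200 * max 1 (1 / \<alpha>)"
  have Q1: "1 \<le> Q" by (simp add: Q_def)
  from nearly_full_sumset[OF Q1]
  obtain C where C1: "1 \<le> C" and C: "\<forall>(X::int set) (Y::int set) m n R L J. X \<subseteq> {0..<m} \<longrightarrow> Y \<subseteq> {0..<n} \<longrightarrow>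
     1 \<le> R \<longrightarrow> 1 \<le> J \<longrightarrow>
     L = R * 4 ^ J \<longrightarrow> 100 * L \<le> m \<longrightarrow> 100 * L \<le> n \<longrightarrow> of_int m \<le> Q * of_int L \<longrightarrow> of_int n \<le> Q * of_int L \<longrightarrow>
     holes X 0 m + holes Y 0 n \<le> of_int L / 10000 \<longrightarrow>
     (\<exists>X'\<subseteq>X. \<exists>Y'\<subseteq>Y. real (card X') \<le> C * 2 ^ J \<and> real (card Y') \<le> C * (of_int R * 2 ^ J) \<and>
        card X + card Y \<le> card (X' + Y') + 1)"
    by (elim exE conjE) (rule that; assumption)
  define D where "D = 8 * C"
  have D8: "8 \<le> D" using C1 by (simp add: D_def)
  \<comment> \<open>Since \<open>c2\<close> is at most the larger cardinality, the product condition
    gives \<open>c \<le> c1\<close>, hence \<open>2 D \<le> c1\<close> and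
    \<open>800 \<le> c1\<close>. The summand \<open>2 D^2\<close> gives
    \<open>D^2 n0 \<le> c1 c2\<close>, because \<open>X\<close> has at least \<open>n0 / 2\<close>
    elements.\<close>
  define c where "c = 2 * D\<^sup>2 + 2 * D + 800"
  have c_pos: "0 < c" "2 * D \<le> c" "800 \<le> c" "2 * D\<^sup>2 \<le> c" using D8 by (auto simp: c_def add_nonneg_pos)
  show ?thesis
  proof (intro exI[of _ c] allI impI)
    fix X Y :: "int set" and m n :: int and c1 c2 :: nat
    assume X: "X \<subseteq> {0..<m}" and Y: "Y \<subseteq> {0..<n}" and c1: "1 \<le> c1" "c1 \<le> card X" and c2: "1 \<le> c2" "c2 \<le> card Y"
      and c12: "c1 \<le> c2" and prod: "c * real (max (card X) (card Y)) \<le> real (c1 * c2)"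
      and mn: "\<alpha> * of_int n \<le> of_int m" "\<alpha> * of_int m \<le> of_int n"
      and hX: "holes X 0 m \<le> 1 / 4000000 * of_int (min m n)" and hY: "holes Y 0 n \<le> 1 / 4000000 * of_int (min m n)"
    have fin: "finite X" "finite Y" using X Y by (auto intro: finite_subset)
    define n0 where "n0 = min m n"
    have "c * real c2 \<le> c * real (max (card X) (card Y))" using c2 c_pos by (intro mult_left_mono) auto
    then have "c * real c2 \<le> real c1 * real c2" using prod by simp
    then have cc1: "c \<le> real c1" using c2 by simp
    have cX: "card X \<le> nat m" using card_mono[OF _ X] by simp
    have cY: "card Y \<le> nat n" using card_mono[OF _ Y] by simp
    have "(800::real) \<le> real c1" using cc1 c_pos by linarith
    then have "800 \<le> c1" by simp
    then have n0: "800 \<le> n0" using c1 c2 c12 cX cY by (auto simp: n0_def)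
    then have mn0: "0 \<le> m" "0 \<le> n" by (auto simp: n0_def)
    have "real (card X) + holes X 0 m = of_int (m - 0)"
      using holes_plus_card[of 0 m X] mn0 X by (auto simp: Int_absorb2)
    then have "of_int n0 \<le> 2 * real (card X)" using hX n0 by (simp add: n0_def)
    then have X2: "of_int n0 / 2 \<le> real (max (card X) (card Y))" by simp
    have "D\<^sup>2 * of_int n0 = (2 * D\<^sup>2) * (of_int n0 / 2)" by simp
    also have "\<dots> \<le> c * real (max (card X) (card Y))" using X2 c_pos n0 by (intro mult_mono) auto
    also have "\<dots> \<le> real c1 * real c2" using prod by simp
    finally have pr: "D\<^sup>2 * of_int n0 \<le> real c1 * real c2" .
    from balanced_scale[OF D8 _ _ n0 pr] cc1 c_pos c12
    obtain R J L where RJ: "1 \<le> R" "1 \<le> (J::nat)" and L: "L = R * 4 ^ J" and Ln: "100 * L \<le> n0" "n0 \<le> 200 * L"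
      and b1: "D * 2 ^ J \<le> real c1" and b2: "D / 8 * (of_int R * 2 ^ J) \<le> real c2" by auto
    have L0: "(0::real) < of_int L" using Ln n0 by simp
    have Ln': "real_of_int n0 \<le> 200 * of_int L" using Ln(2) by linarith
    have bound: "max (real_of_int m) (of_int n) \<le> Q * of_int L"
    proof -
      have "max (real_of_int m) (of_int n) \<le> max 1 (1 / \<alpha>) * of_int n0"
      proof -
        have "real_of_int m \<le> 1 / \<alpha> * of_int n" "real_of_int n \<le> 1 / \<alpha> * of_int m"
          using mn \<alpha> by (auto simp: field_simps)
        moreover have "1 / \<alpha> * x \<le> max 1 (1 / \<alpha>) * x" "x \<le> max 1 (1 / \<alpha>) * x" if "0 \<le> x" for x :: real
          using that mult_right_mono[of "1/\<alpha>" "max 1 (1/\<alpha>)" x] mult_right_mono[of 1 "max 1 (1/\<alpha>)" x] by auto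
        moreover have "0 \<le> real_of_int m" "0 \<le> real_of_int n" using mn0 by auto
        ultimately have "real_of_int m \<le> max 1 (1 / \<alpha>) * of_int n" "real_of_int n \<le> max 1 (1 / \<alpha>) * of_int m"
          "real_of_int m \<le> max 1 (1 / \<alpha>) * of_int m" "real_of_int n \<le> max 1 (1 / \<alpha>) * of_int n"
          by (blast intro: order_trans)+
        then show ?thesis unfolding n0_def by (cases "m \<le> n") (simp_all only: min_def if_True if_False max.bounded_iff)
      qed
      also have "\<dots> \<le> max 1 (1 / \<alpha>) * (200 * of_int L)" using Ln' by (intro mult_left_mono) auto
      finally show ?thesis by (simp add: Q_def)
    qed
    \<comment> \<open>Here \<open>1 / 4000000\<close> is fixed: two such fractions of
      \<open>n0 \<le> 200 L\<close> amount to \<open>L / 10000\<close>.\<close>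
    have "holes X 0 m + holes Y 0 n \<le> of_int L / 10000" using hX hY Ln' unfolding n0_def[symmetric] by simp
    with C[rule_format, OF X Y RJ L _ _ _ _ this] bound Ln
    obtain X1 Y1 where 1: "X1 \<subseteq> X" "Y1 \<subseteq> Y" "real (card X1) \<le> C * 2 ^ J" "real (card Y1) \<le> C * (of_int R * 2 ^ J)"
        "card X + card Y \<le> card (X1 + Y1) + 1" by (auto simp: n0_def)
    \<comment> \<open>The sets found are within the prescribed sizes; padding them to exactly
      \<open>c1\<close> and \<open>c2\<close> elements only enlarges the sumset.\<close>
    have "C * 2 ^ J \<le> D * 2 ^ J" using C1 by (simp add: D_def)
    then have "card X1 \<le> c1" using 1(3) b1 by linarith
    then obtain X' where X': "X1 \<subseteq> X'" "X' \<subseteq> X" "card X' = c1"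
      using exists_subset_between[of X1 c1 X] 1 c1 fin by blast
    have "card Y1 \<le> c2" using 1(4) b2 by (simp add: D_def)
    then obtain Y' where Y': "Y1 \<subseteq> Y'" "Y' \<subseteq> Y" "card Y' = c2"
      using exists_subset_between[of Y1 c2 Y] 1 c2 fin by blast
    have "finite (X' + Y')" using X' Y' fin by (intro finite_set_plus) (auto intro: finite_subset)
    then have "card (X1 + Y1) \<le> card (X' + Y')" using X' Y' by (intro card_mono set_plus_mono2) auto
    then show "\<exists>X'\<subseteq>X. \<exists>Y'\<subseteq>Y. card X' = c1 \<and> card Y' = c2 \<and> card X + card Y \<le> card (X' + Y') + 1"
      using 1 X' Y' by (intro exI[of _ X'] conjI exI[of _ Y']) auto
  qed
qed

lemma few_summands:
  fixes \<alpha> :: real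
  assumes \<alpha>: "0 < \<alpha>"
  shows "\<exists>c. \<forall>(X::int set) (Y::int set) m n c1 c2. X \<subseteq> {0..<m} \<longrightarrow> Y \<subseteq> {0..<n} \<longrightarrow>
     1 \<le> c1 \<longrightarrow> c1 \<le> card X \<longrightarrow> 1 \<le> c2 \<longrightarrow> c2 \<le> card Y \<longrightarrow>
     c * real (max (card X) (card Y)) \<le> real (c1 * c2) \<longrightarrow>
     \<alpha> * of_int n \<le> of_int m \<longrightarrow> \<alpha> * of_int m \<le> of_int n \<longrightarrow>
     holes X 0 m \<le> 1 / 4000000 * of_int (min m n) \<longrightarrow> holes Y 0 n \<le> 1 / 4000000 * of_int (min m n) \<longrightarrow>
     (\<exists>X'\<subseteq>X. \<exists>Y'\<subseteq>Y. card X' = c1 \<and> card Y' = c2 \<and> card X + card Y \<le> card (X' + Y') + 1)"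
proof -
  from few_summands_ordered[OF \<alpha>]
  obtain c where c: "\<forall>(X::int set) (Y::int set) m n c1 c2. X \<subseteq> {0..<m} \<longrightarrow> Y \<subseteq> {0..<n} \<longrightarrow>
     1 \<le> c1 \<longrightarrow> c1 \<le> card X \<longrightarrow> 1 \<le> c2 \<longrightarrow> c2 \<le> card Y \<longrightarrow> c1 \<le> c2 \<longrightarrow>
     c * real (max (card X) (card Y)) \<le> real (c1 * c2) \<longrightarrow>
     \<alpha> * of_int n \<le> of_int m \<longrightarrow> \<alpha> * of_int m \<le> of_int n \<longrightarrow>
     holes X 0 m \<le> 1 / 4000000 * of_int (min m n) \<longrightarrow> holes Y 0 n \<le> 1 / 4000000 * of_int (min m n) \<longrightarrow>
     (\<exists>X'\<subseteq>X. \<exists>Y'\<subseteq>Y. card X' = c1 \<and> card Y' = c2 \<and> card X + card Y \<le> card (X' + Y') + 1)"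
    by (elim exE conjE) (rule that; assumption)
  show ?thesis
  proof (intro exI[of _ c] allI impI)
    fix X Y :: "int set" and m n :: int and c1 c2 :: nat
    assume as: "X \<subseteq> {0..<m}" "Y \<subseteq> {0..<n}" "1 \<le> c1" "c1 \<le> card X" "1 \<le> c2" "c2 \<le> card Y"
      "c * real (max (card X) (card Y)) \<le> real (c1 * c2)"
      "\<alpha> * of_int n \<le> of_int m" "\<alpha> * of_int m \<le> of_int n"
      "holes X 0 m \<le> 1 / 4000000 * of_int (min m n)" "holes Y 0 n \<le> 1 / 4000000 * of_int (min m n)"
    show "\<exists>X'\<subseteq>X. \<exists>Y'\<subseteq>Y. card X' = c1 \<and> card Y' = c2 \<and> card X + card Y \<le> card (X' + Y') + 1"
    proof (cases "c1 \<le> c2")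
      case True
      show ?thesis by (rule c[rule_format, OF as(1-6) True as(7-11)])
    next
      case False
      have "\<exists>Y'\<subseteq>Y. \<exists>X'\<subseteq>X. card Y' = c2 \<and> card X' = c1 \<and> card Y + card X \<le> card (Y' + X') + 1"
        by (rule c[rule_format, OF as(2) as(1) as(5) as(6) as(3) as(4)])
           (use as False in \<open>auto simp: max.commute min.commute mult.commute\<close>)
      then obtain Y' X' where "Y' \<subseteq> Y" "X' \<subseteq> X" "card Y' = c2" "card X' = c1"
        "card Y + card X \<le> card (Y' + X') + 1" by blast
      then show ?thesis
        by (intro exI[of _ X'] conjI exI[of _ Y']) (simp_all add: add.commute[of X' Y'])
    qed
  qed
qed

section \<open>Transfer to residues\<close>

lemma inj_on_add_mod:
  fixes a p :: int
  shows "inj_on (\<lambda>i. (a + i) mod p) {0..<p}"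
proof (rule inj_onI)
  fix i j assume ij: "i \<in> {0..<p}" "j \<in> {0..<p}" and "(a + i) mod p = (a + j) mod p"
  then have "((a + i) - a) mod p = ((a + j) - a) mod p" by (intro mod_diff_cong) auto
  then show "i = j" using ij by simp
qed

text \<open>An interval given with \<open>m \<ge> p\<close> would contain all \<open>p\<close>
  residues; so \<open>card I < p\<close> forces \<open>m < p\<close>, and then
  \<open>m = card I\<close>.\<close>

lemma residue_interval_translate:
  assumes I: "residue_interval p I" and cI: "card I < p"
  obtains a where "I = (\<lambda>i. (a + i) mod int p) ` {0..<int (card I)}"
proof -
  from I obtain a m where am: "I = (\<lambda>i. (a + int i) mod int p) ` {..<m}" unfolding residue_interval_def by blast
  have I': "I = (\<lambda>i. (a + i) mod int p) ` {0..<int m}"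
    unfolding am lessThan_atLeast0 by (simp only: image_int_atLeastLessThan[of 0 m, simplified, symmetric] image_image)
  have "m < p"
  proof (rule ccontr)
    assume "\<not> m < p"
    then have "(\<lambda>i. (a + i) mod int p) ` {0..<int p} \<subseteq> I" unfolding I' by (intro image_mono) auto
    then have "card ((\<lambda>i. (a + i) mod int p) ` {0..<int p}) \<le> card I" by (intro card_mono) (auto simp: I')
    then show False using cI by (simp add: card_image[OF inj_on_add_mod])
  qed
  then have "card I = m" unfolding I'
    by (subst card_image) (auto intro: inj_on_subset[OF inj_on_add_mod])
  with I' show thesis by (intro that[of a]) simp
qed

lemma preimage_in_interval:
  fixes a p m :: int
  assumes mp: "m \<le> p" and I: "I = (\<lambda>i. (a + i) mod p) ` {0..<m}" and X: "X \<subseteq> I"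
    and X0: "X0 = {i \<in> {0..<m}. (a + i) mod p \<in> X}"
  shows "(\<lambda>i. (a + i) mod p) ` X0 = X" "card X0 = card X" "holes X0 0 m = real (card (I - X))"
proof -
  have inj: "inj_on (\<lambda>i. (a + i) mod p) {0..<m}"
    using mp by (intro inj_on_subset[OF inj_on_add_mod]) auto
  show im: "(\<lambda>i. (a + i) mod p) ` X0 = X" using X unfolding X0 I by auto
  have "inj_on (\<lambda>i. (a + i) mod p) X0" by (rule inj_on_subset[OF inj]) (auto simp: X0)
  then show "card X0 = card X" using im card_image by fastforce
  have "(\<lambda>i. (a + i) mod p) ` ({0..<m} - X0) = I - X" unfolding X0 I by auto
  moreover have "inj_on (\<lambda>i. (a + i) mod p) ({0..<m} - X0)" by (rule inj_on_subset[OF inj]) auto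
  ultimately have "card ({0..<m} - X0) = card (I - X)" using card_image by fastforce
  then show "holes X0 0 m = real (card (I - X))" by (simp add: holes_def)
qed

lemma residue_sumset_image:
  "(\<lambda>i. (a + i) mod p) ` A <+>\<^bsub>residue_ring p\<^esub> (\<lambda>j. (b + j) mod p) ` B
     = (\<lambda>s. (a + b + s) mod p) ` (A + B)"
proof -
  have eq: "((a + i) mod p + (b + j) mod p) mod p = (a + b + (i + j)) mod p" for i j :: int
    by (simp add: mod_add_eq algebra_simps)
  have "(\<lambda>i. (a + i) mod p) ` A <+>\<^bsub>residue_ring p\<^esub> (\<lambda>j. (b + j) mod p) ` B
      = (\<Union>i\<in>A. \<Union>j\<in>B. {((a + i) mod p + (b + j) mod p) mod p})"
    by (auto simp: set_add_def' residue_ring_def)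
  also have "\<dots> = (\<Union>i\<in>A. \<Union>j\<in>B. {(a + b + (i + j)) mod p})" by (simp only: eq)
  also have "\<dots> = (\<lambda>s. (a + b + s) mod p) ` (A + B)" by (auto simp: set_plus_def)
  finally show ?thesis .
qed

theorem theorem7:
  shows "\<exists>\<gamma>::real. \<gamma> > 0 \<and> (\<forall>\<alpha>::real. \<alpha> > 0 \<longrightarrow> (\<exists>c::real.
    \<forall>(p::nat) (I::int set) (J::int set) (X::int set) (Y::int set) (c\<^sub>1::nat) (c\<^sub>2::nat).
      prime p \<longrightarrow>
      residue_interval p I \<longrightarrow> residue_interval p J \<longrightarrow>
      X \<subseteq> I \<longrightarrow> Y \<subseteq> J \<longrightarrow>
      1 \<le> c\<^sub>1 \<and> c\<^sub>1 \<le> card X \<longrightarrow> 1 \<le> c\<^sub>2 \<and> c\<^sub>2 \<le> card Y \<longrightarrow>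
      real (c\<^sub>1 * c\<^sub>2) \<ge> c * real (max (card X) (card Y)) \<longrightarrow>
      \<alpha> * real (card J) \<le> real (card I) \<and> real (card I) \<le> inverse \<alpha> * real (card J) \<longrightarrow>
      card I + card J \<le> p \<longrightarrow>
      real (max (card (I - X)) (card (J - Y))) \<le> \<gamma> * real (min (card I) (card J)) \<longrightarrow>
      (\<exists>X' \<in> [X]\<^bsup>c\<^sub>1\<^esup>. \<exists>Y' \<in> [Y]\<^bsup>c\<^sub>2\<^esup>.
         card (X' <+>\<^bsub>residue_ring (int p)\<^esub> Y') \<ge> card X + card Y - 1)))"
proof (rule exI[of _ "1 / 4000000"], intro conjI allI impI)
  fix \<alpha> :: real assume \<alpha>: "\<alpha> > 0"
  from few_summands[OF \<alpha>] obtain c where c: "\<forall>(X::int set) (Y::int set) m n c1 c2. X \<subseteq> {0..<m} \<longrightarrow> Y \<subseteq> {0..<n} \<longrightarrow>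
     1 \<le> c1 \<longrightarrow> c1 \<le> card X \<longrightarrow> 1 \<le> c2 \<longrightarrow> c2 \<le> card Y \<longrightarrow>
     c * real (max (card X) (card Y)) \<le> real (c1 * c2) \<longrightarrow>
     \<alpha> * of_int n \<le> of_int m \<longrightarrow> \<alpha> * of_int m \<le> of_int n \<longrightarrow>
     holes X 0 m \<le> 1 / 4000000 * of_int (min m n) \<longrightarrow> holes Y 0 n \<le> 1 / 4000000 * of_int (min m n) \<longrightarrow>
     (\<exists>X'\<subseteq>X. \<exists>Y'\<subseteq>Y. card X' = c1 \<and> card Y' = c2 \<and> card X + card Y \<le> card (X' + Y') + 1)"
    by (elim exE) (rule that; assumption)
  have main: "\<exists>X' \<in> [X]\<^bsup>c1\<^esup>. \<exists>Y' \<in> [Y]\<^bsup>c2\<^esup>. card (X' <+>\<^bsub>residue_ring (int p)\<^esub> Y') \<ge> card X + card Y - 1"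
    if p: "prime p" and I: "residue_interval p I" and J: "residue_interval p J" and X: "X \<subseteq> I" and Y: "Y \<subseteq> J"
      and c1: "1 \<le> c1" "c1 \<le> card X" and c2: "1 \<le> c2" "c2 \<le> card Y"
      and prod: "real (c1 * c2) \<ge> c * real (max (card X) (card Y))"
      and \<alpha>I: "\<alpha> * real (card J) \<le> real (card I)" "real (card I) \<le> inverse \<alpha> * real (card J)"
      and IJ: "card I + card J \<le> p"
      and hol: "real (max (card (I - X)) (card (J - Y))) \<le> 1 / 4000000 * real (min (card I) (card J))"
    for p I J X Y c1 c2
  proof -
    have fin: "finite I" "finite J" using I J unfolding residue_interval_def by auto
    have cX: "card X \<le> card I" "card Y \<le> card J" using X Y fin by (auto intro: card_mono)
    define m where "m = int (card I)"
    define n where "n = int (card J)"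
    have mn: "1 \<le> m" "1 \<le> n" "m + n \<le> int p" using cX c1 c2 IJ by (auto simp: m_def n_def)
    have lt: "card I < p" "card J < p" using mn by (auto simp: m_def n_def)
    obtain a where a: "I = (\<lambda>i. (a + i) mod int p) ` {0..<m}"
      using residue_interval_translate[OF I lt(1)] unfolding m_def by blast
    obtain b where b: "J = (\<lambda>i. (b + i) mod int p) ` {0..<n}"
      using residue_interval_translate[OF J lt(2)] unfolding n_def by blast
    define X0 where "X0 = {i \<in> {0..<m}. (a + i) mod int p \<in> X}"
    define Y0 where "Y0 = {i \<in> {0..<n}. (b + i) mod int p \<in> Y}"
    have mp: "m \<le> int p" "n \<le> int p" using mn by auto
    note X0 = preimage_in_interval[OF mp(1) a X X0_def]
    note Y0 = preimage_in_interval[OF mp(2) b Y Y0_def]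
    have "\<exists>X'\<subseteq>X0. \<exists>Y'\<subseteq>Y0. card X' = c1 \<and> card Y' = c2 \<and> card X0 + card Y0 \<le> card (X' + Y') + 1"
    proof (rule c[rule_format])
      show "X0 \<subseteq> {0..<m}" "Y0 \<subseteq> {0..<n}" by (auto simp: X0_def Y0_def)
      show "\<alpha> * of_int n \<le> of_int m" using \<alpha>I by (simp add: m_def n_def)
      show "\<alpha> * of_int m \<le> of_int n" using \<alpha>I(2) \<alpha> by (simp add: m_def n_def field_simps)
      have mi: "real (min (card I) (card J)) = of_int (min m n)" by (simp add: m_def n_def min_def)
      show "holes X0 0 m \<le> 1 / 4000000 * of_int (min m n)" "holes Y0 0 n \<le> 1 / 4000000 * of_int (min m n)"
        using hol unfolding X0(3) Y0(3) mi by (simp_all add: of_nat_max)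
    qed (use c1 c2 prod X0 Y0 in auto)
    then obtain X1 Y1 where 1: "X1 \<subseteq> X0" "Y1 \<subseteq> Y0" "card X1 = c1" "card Y1 = c2"
      "card X0 + card Y0 \<le> card (X1 + Y1) + 1" by blast
    have s1: "X1 \<subseteq> {0..<m}" "Y1 \<subseteq> {0..<n}" using 1 by (auto simp: X0_def Y0_def)
    define X' where "X' = (\<lambda>i. (a + i) mod int p) ` X1"
    define Y' where "Y' = (\<lambda>i. (b + i) mod int p) ` Y1"
    have "card X' = c1" unfolding X'_def 1(3)[symmetric] using s1 mp
      by (intro card_image inj_on_subset[OF inj_on_add_mod]) auto
    moreover have "card Y' = c2" unfolding Y'_def 1(4)[symmetric] using s1 mp
      by (intro card_image inj_on_subset[OF inj_on_add_mod]) auto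
    moreover have "X' \<subseteq> X" "Y' \<subseteq> Y" using 1 X0(1) Y0(1) unfolding X'_def Y'_def by blast+
    moreover have "finite X'" "finite Y'" using s1 unfolding X'_def Y'_def by (auto intro: finite_subset)
    ultimately have "X' \<in> [X]\<^bsup>c1\<^esup>" "Y' \<in> [Y]\<^bsup>c2\<^esup>" by (auto simp: nsets_def)
    moreover have "card (X' <+>\<^bsub>residue_ring (int p)\<^esub> Y') = card (X1 + Y1)"
    proof -
      \<comment> \<open>There is no wrap-around: since \<open>m + n \<le> p\<close>, distinct
        integer sums stay distinct modulo \<open>p\<close>.\<close>
      have "X1 + Y1 \<subseteq> {0..<int p}"
      proof
        fix s assume "s \<in> X1 + Y1"
        then obtain x y where "s = x + y" "x \<in> {0..<m}" "y \<in> {0..<n}" using s1 by (blast elim: set_plus_elim)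
        then show "s \<in> {0..<int p}" using mn by auto
      qed
      then show ?thesis unfolding X'_def Y'_def residue_sumset_image
        by (intro card_image inj_on_subset[OF inj_on_add_mod])
    qed
    ultimately show ?thesis using 1(5) X0(2) Y0(2) by (intro bexI[of _ X'] bexI[of _ Y']) auto
  qed
  show "\<exists>c::real.
    \<forall>(p::nat) (I::int set) (J::int set) (X::int set) (Y::int set) (c\<^sub>1::nat) (c\<^sub>2::nat).
      prime p \<longrightarrow>
      residue_interval p I \<longrightarrow> residue_interval p J \<longrightarrow>
      X \<subseteq> I \<longrightarrow> Y \<subseteq> J \<longrightarrow>
      1 \<le> c\<^sub>1 \<and> c\<^sub>1 \<le> card X \<longrightarrow> 1 \<le> c\<^sub>2 \<and> c\<^sub>2 \<le> card Y \<longrightarrow>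
      real (c\<^sub>1 * c\<^sub>2) \<ge> c * real (max (card X) (card Y)) \<longrightarrow>
      \<alpha> * real (card J) \<le> real (card I) \<and> real (card I) \<le> inverse \<alpha> * real (card J) \<longrightarrow>
      card I + card J \<le> p \<longrightarrow>
      real (max (card (I - X)) (card (J - Y))) \<le> 1 / 4000000 * real (min (card I) (card J)) \<longrightarrow>
      (\<exists>X' \<in> [X]\<^bsup>c\<^sub>1\<^esup>. \<exists>Y' \<in> [Y]\<^bsup>c\<^sub>2\<^esup>.
         card (X' <+>\<^bsub>residue_ring (int p)\<^esub> Y') \<ge> card X + card Y - 1)"
    by (rule exI[of _ c], intro allI impI, elim conjE) (rule main; assumption)
qed simp

end
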